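(* The chambers of $\mathrm{I}(\mathfrak{sl}_n,V\oplus\bigwedge^2)$ satisfy the following. (a) For $n\ge3$, every chamber of $\mathrm{I}(\mathfrak{sl}_n,V\oplus\bigwedge^2)$ is uniquely expressible as $C\cap\mathfrak h_s$, where $C$ is a chamber of $\mathrm{I}(\mathfrak{gl}_n,V\oplus\bigwedge^2)$. (b) For $n\ge 0$, the number of chambers of $\mathrm{I}(\mathfrak{sl}_n,V\oplus\bigwedge^2)$ is $$2^n-2\binom{n}{\lfloor n/2\rfloor}+\delta_{n,0}+\delta_{n,1}+\delta_{n,2},$$ which is the coefficient of $x^n$ in the generating function $$\frac{1}{1-2x}-\frac{\sqrt{1-4x^2}+2x-1}{x(1-2x)}+1+x+x^2=\frac{2x^4+x^3+x^2+\sqrt{1-4x^2}-1}{x(2x-1)} .$$ (c) Let $n\ge3$, let $S=\{a_1>\cdots>a_k\}\subseteq[n]$, put $a_i=0$ for $i>k$, and let $C=C(S)$ be the corresponding chamber of $\mathrm{I}(\mathfrak{gl}_n,V\oplus\bigwedge^2)$. Then $C\cap\mathfrak h_s$ is a chamber of $\mathrm{I}(\mathfrak{sl}_n,V\oplus\bigwedge^2)$ if and only if there exist indices $1\le i,j\le\lceil n/2\rceil$ such that $$a_i\ge n+2-2i\quad\text{and}\quad a_j<n+2-2j .$$ This occurs if and only if $C$ has a positive level and a negative level.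
   Context: $[n]=\{1,\dots,n\}$. Let $\mathfrak h=\mathbb{R}^n$ with coordinates $x_1,\dots,x_n$, $\mathfrak h_s=\{x_1+\cdots+x_n=0\}$, $W=\{x_1\ge\cdots\ge x_n\}$, $W_s=W\cap\mathfrak h_s$. The weights are the functionals $x_i$ ($1\le i\le n$) and $x_i+x_j$ ($1\le i<j\le n$). $\mathrm{I}(\mathfrak{gl}_n,V\oplus\bigwedge^2)$ (resp. $\mathrm{I}(\mathfrak{sl}_n,V\oplus\bigwedge^2)$) is the arrangement of the kernels of the weights in $\mathfrak h$ (resp. $\mathfrak h_s$), considered only inside $W$ (resp. $W_s$). A chamber is the closure of a connected component of the set of points in the interior of $W$ (resp. of $W_s$ relative to $\mathfrak h_s$) at which no weight that is not identically zero on $\mathfrak h$ (resp. $\mathfrak h_s$) vanishes. Thus chambers of the $\mathfrak{sl}_n$ geometry are $(n-1)$-dimensional; for $n=0$ the convention is that there are none. For $S=\{a_1>\cdots>a_k\}\subseteq[n]$, $C(S)$ is the set of points of $W$ such that, for all $1\le i\le j\le n$, $x_i+x_j\ge0$ if $i\le k$ and $j\le a_i+i-1$, and $x_i+x_j\le0$ otherwise. (It is known that $S\mapsto C(S)$ is a bijection from the subsets of $[n]$ to the chambers of $\mathrm{I}(\mathfrak{gl}_n,V\oplus\bigwedge^2)$.) The characteristic vector of $C(S)$ is $(s_1,\dots,s_n)\in\{-1,1\}^n$ with $s_i=1$ if $i\in S$ and $s_i=-1$ otherwise. An index $1\le i\le n$ is a positive (resp. negative) level for $C(S)$ if $s_{n-i+1}+\cdots+s_n>0$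 (resp. $<0$). The square root is the power series with constant term $1$. *)

theory Defs
  imports
    "HOL-Analysis.Analysis"
    "HOL-Computational_Algebra.Formal_Laurent_Series"
begin

section \<open>The arrangements\<close>

text \<open>
  A point of \<open>\<real>\<^sup>n\<close> is a function on the index set \<open>{1..n}\<close>, represented as in the library's product
  topology: it takes the value \<^const>\<open>undefined\<close> outside \<open>{1..n}\<close>.
\<close>

definition gl_space :: "nat \<Rightarrow> (nat \<Rightarrow> real) topology" where
  "gl_space n = powertop_real {1..n}"

definition sl_hyperplane :: "nat \<Rightarrow> (nat \<Rightarrow> real) set" where
  "sl_hyperplane n = {x \<in> topspace (gl_space n). (\<Sum>i=1..n. x i) = 0}"

definition sl_space :: "nat \<Rightarrow> (nat \<Rightarrow> real) topology" where
  "sl_space n = subtopology (gl_space n) (sl_hyperplane n)"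

definition weyl_chamber :: "nat \<Rightarrow> (nat \<Rightarrow> real) set" where
  "weyl_chamber n = {x \<in> topspace (gl_space n). antimono_on {1..n} x}"

definition weights :: "nat \<Rightarrow> ((nat \<Rightarrow> real) \<Rightarrow> real) set" where
  "weights n = {\<lambda>x. x i | i. 1 \<le> i \<and> i \<le> n} \<union> {\<lambda>x. x i + x j | i j. 1 \<le> i \<and> i < j \<and> j \<le> n}"

text \<open>
  In the next two definitions the ambient space \<open>X\<close> is \<^term>\<open>gl_space n\<close> or \<^term>\<open>sl_space n\<close>; the
  dominant cone, its interior, the nonvanishing of a weight, and the closure are all relative to \<open>X\<close>.
\<close>

definition regular_points :: "nat \<Rightarrow> (nat \<Rightarrow> real) topology \<Rightarrow> (nat \<Rightarrow> real) set" where
  "regular_points n X =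
     {x \<in> X interior_of (weyl_chamber n \<inter> topspace X).
        \<forall>w\<in>weights n. (\<exists>y\<in>topspace X. w y \<noteq> 0) \<longrightarrow> w x \<noteq> 0}"

definition chambers_in :: "nat \<Rightarrow> (nat \<Rightarrow> real) topology \<Rightarrow> (nat \<Rightarrow> real) set set" where
  "chambers_in n X =
     (\<lambda>K. X closure_of K) ` connected_components_of (subtopology X (regular_points n X))"

definition gl_chambers :: "nat \<Rightarrow> (nat \<Rightarrow> real) set set" where
  "gl_chambers n = chambers_in n (gl_space n)"

text \<open>
  For \<open>n = 0\<close> the hyperplane degenerates to the single point of \<open>\<real>\<^sup>0\<close>; by convention there are no
  chambers then, since a chamber is to have dimension \<open>n - 1\<close>.
\<close>

definition sl_chambers :: "nat \<Rightarrow> (nat \<Rightarrow> real) set set" where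
  "sl_chambers n = (if n = 0 then {} else chambers_in n (sl_space n))"

section \<open>The chambers indexed by subsets of \<open>{1..n}\<close>\<close>

text \<open>\<open>desc S i\<close> is the \<open>i\<close>-th largest element of \<open>S\<close>, counted from 1, and 0 for \<open>i > card S\<close>.\<close>

definition desc :: "nat set \<Rightarrow> nat \<Rightarrow> nat" where
  "desc S i = (if 1 \<le> i \<and> i \<le> card S then rev (sorted_list_of_set S) ! (i - 1) else 0)"

definition chamber_of :: "nat \<Rightarrow> nat set \<Rightarrow> (nat \<Rightarrow> real) set" where
  "chamber_of n S =
     {x \<in> weyl_chamber n. \<forall>i j. 1 \<le> i \<and> i \<le> j \<and> j \<le> n \<longrightarrow>
        (if i \<le> card S \<and> j \<le> desc S i + i - 1 then x i + x j \<ge> 0 else x i + x j \<le> 0)}"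

definition char_vec :: "nat set \<Rightarrow> nat \<Rightarrow> int" where
  "char_vec S i = (if i \<in> S then 1 else -1)"

definition positive_level :: "nat \<Rightarrow> nat set \<Rightarrow> nat \<Rightarrow> bool" where
  "positive_level n S i \<longleftrightarrow> 1 \<le> i \<and> i \<le> n \<and> (\<Sum>l = n - i + 1..n. char_vec S l) > 0"

definition negative_level :: "nat \<Rightarrow> nat set \<Rightarrow> nat \<Rightarrow> bool" where
  "negative_level n S i \<longleftrightarrow> 1 \<le> i \<and> i \<le> n \<and> (\<Sum>l = n - i + 1..n. char_vec S l) < 0"

section \<open>The square root in the generating function\<close>

text \<open>\<open>sqrt (1 - 4x\<^sup>2)\<close>, as a Laurent series so that division by \<open>x\<close> is division in a field.\<close>

definition sqrt_fps :: "real fps" where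
  "sqrt_fps = fps_radical root 2 (1 - 4 * fps_X ^ 2)"

definition sqrt_fls :: "real fls" where
  "sqrt_fls = fps_to_fls sqrt_fps"

lemma sqrt_fps_characterization:
  "f = sqrt_fps \<longleftrightarrow> f ^ 2 = 1 - 4 * fps_X ^ 2 \<and> fps_nth f 0 = 1"
proof -
  have c: "fps_nth (1 - 4 * fps_X ^ 2 :: real fps) 0 = 1"
    by (simp add: power2_eq_square)
  have sq: "sqrt_fps ^ 2 = 1 - 4 * fps_X ^ 2"
    using power_radical[of "1 - 4 * fps_X ^ 2 :: real fps" root 1] c
    by (simp add: sqrt_fps_def numeral_2_eq_2)
  have c0: "fps_nth sqrt_fps 0 = 1"
    using c by (simp add: sqrt_fps_def)
  show ?thesis
  proof
    assume f: "f ^ 2 = 1 - 4 * fps_X ^ 2 \<and> fps_nth f 0 = 1"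
    then have "f = sqrt_fps \<or> f = - sqrt_fps"
      using sq by (metis power2_eq_iff)
    then show "f = sqrt_fps"
      using f c0 by auto
  qed (use sq c0 in auto)
qed

end

theory Submission
  imports Defs
begin

text \<open>
  Inside the dominant cone, the regular points of \<open>\<real>\<^sup>n\<close> are the strictly decreasing points with
  \<open>x\<^sub>i + x\<^sub>j \<noteq> 0\<close> for all \<open>i \<le> j\<close>, so that their coordinates have distinct nonzero absolute values.
  Such a point is determined by the increasing list \<open>c\<^sub>1 < \<dots> < c\<^sub>n\<close> of its absolute values together
  with the set \<open>S\<close> of ranks \<open>l\<close> for which \<open>c\<^sub>l\<close> occurs with a positive sign. The signs of all
  \<open>x\<^sub>i + x\<^sub>j\<close> depend on \<open>S\<close> only, and they are the strict inequalities behind the chamber of \<open>S\<close>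
  (\<open>generic_in_open_cell\<close>, \<open>positive_ranks_open_cell\<close>). The regular set is therefore the disjoint
  union of the convex open cells of the subsets \<open>S\<close>, and each cell has the chamber of \<open>S\<close> as its
  closure.

  For \<open>n \<ge> 3\<close> no weight vanishes identically on the hyperplane of sum 0, and the same description
  holds there: the components are the nonempty intersections of the open cells with the hyperplane,
  and their closures are the intersections of the chambers with it (\<open>chambers_in_slice\<close>). An interior
  point of such an intersection lies in no chamber of any other subset, which gives uniqueness.

  It remains to decide which cells meet the hyperplane. On the cell of \<open>S\<close> the coordinate sum is
  \<open>\<Sum> s\<^sub>l c\<^sub>l\<close> with the characteristic vector \<open>s\<close>, and in terms of the increments of \<open>c\<close> it is a
  combination of the suffix sums of \<open>s\<close> with arbitrary positive coefficients. As the last suffix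
  sum is \<open>\<plusminus>1\<close>, this combination can vanish exactly when suffix sums of both signs occur, that is, when
  there are a positive and a negative level (\<open>open_cell_meets_hyperplane_iff\<close>). The suffix sum of
  length \<open>2 i - 1\<close> is positive exactly when at least \<open>i\<close> of the top \<open>2 i - 1\<close> indices belong to \<open>S\<close>,
  which is the inequality for \<open>a\<^sub>i\<close> (\<open>desc_condition_iff_levels\<close>).

  The number of chambers is thus the number of sign sequences whose partial sums, read from the top,
  take both signs. By the reflection principle \<open>C(n, \<lfloor>n/2\<rfloor>)\<close> sequences stay nonnegative and, by
  symmetry, as many stay nonpositive (\<open>card_mixed_subsets\<close>). The generating function of these
  binomial coefficients comes from that of the central ones, which is the inverse of a square root.
\<close>

text \<open>Index sets start at 1, and terms such as \<open>{1..n}\<close> are to keep this form under simplification.\<close>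

declare One_nat_def [simp del]

section \<open>Connected components of a disjoint union of open connected sets\<close>

text \<open>
  Each of the sets is open and so is the union of the others. A connected set that meets one of them
  therefore stays inside it.
\<close>

lemma connected_components_of_disjoint_open:
  assumes conn: "\<And>i. i \<in> I \<Longrightarrow> connectedin X (K i)"
    and op: "\<And>i. i \<in> I \<Longrightarrow> openin X (K i)"
    and disj: "\<And>i j. i \<in> I \<Longrightarrow> j \<in> I \<Longrightarrow> i \<noteq> j \<Longrightarrow> K i \<inter> K j = {}"
  shows "connected_components_of (subtopology X (\<Union>i\<in>I. K i)) = {K i | i. i \<in> I \<and> K i \<noteq> {}}"
proof -
  let ?R = "\<Union>i\<in>I. K i"
  let ?Y = "subtopology X ?R"
  have top: "topspace ?Y = ?R"
    using op openin_subset by fastforce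
  have comp: "connected_component_of_set ?Y x = K i" if i: "i \<in> I" and x: "x \<in> K i" for x i
  proof
    have "connectedin ?Y (K i)"
      using conn i by (auto simp: connectedin_subtopology)
    then show "K i \<subseteq> connected_component_of_set ?Y x"
      using x by (rule connected_component_of_maximal)
    let ?C = "connected_component_of_set ?Y x"
    let ?rest = "\<Union>j\<in>I - {i}. K j"
    have C: "connectedin X ?C" "?C \<subseteq> ?R"
      using connectedin_connected_component_of[of ?Y x] by (auto simp: connectedin_subtopology)
    have "openin X ?rest"
      using op by blast
    moreover have "K i \<inter> ?rest = {}"
      using disj i by blast
    moreover have "?R = K i \<union> ?rest"
      using i by blast
    moreover have "x \<in> ?C"
      using i x top by (metis UN_I connected_component_of_refl mem_Collect_eq)
    ultimately have "?rest \<inter> ?C = {}"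
      using connectedinD[OF C(1) op[OF i], of ?rest] C(2) x by blast
    then show "?C \<subseteq> K i"
      using C(2) i by blast
  qed
  show ?thesis
    unfolding connected_components_of_def top using comp by (auto simp: image_iff) blast+
qed

section \<open>Open polyhedral cells in a slice of \<open>\<real>\<^sup>n\<close>\<close>

text \<open>
  The two ambient spaces are treated at once: \<open>U = UNIV\<close> gives \<open>\<real>\<^sup>n\<close>, and \<open>U = {0}\<close> gives the
  hyperplane. For convex \<open>U\<close> a slice contains the segment between any two of its points.
\<close>

definition slice :: "nat \<Rightarrow> real set \<Rightarrow> (nat \<Rightarrow> real) topology" where
  "slice n U = subtopology (gl_space n) {x. (\<Sum>i=1..n. x i) \<in> U}"

definition seg :: "nat \<Rightarrow> (nat \<Rightarrow> real) \<Rightarrow> (nat \<Rightarrow> real) \<Rightarrow> real \<Rightarrow> nat \<Rightarrow> real" where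
  "seg n x y t = (\<lambda>i\<in>{1..n}. x i + t * (y i - x i))"

lemma topspace_gl_space: "topspace (gl_space n) = extensional {1..n}"
  by (auto simp: gl_space_def PiE_def)

lemma topspace_slice: "topspace (slice n U) = {x \<in> extensional {1..n}. (\<Sum>i=1..n. x i) \<in> U}"
  by (auto simp: slice_def topspace_gl_space)

lemma slice_UNIV: "slice n UNIV = gl_space n"
  by (simp add: slice_def)

lemma sl_hyperplane_eq: "sl_hyperplane n = topspace (slice n {0})"
  by (simp add: sl_hyperplane_def topspace_slice topspace_gl_space)

lemma slice_0: "slice n {0} = sl_space n"
proof -
  have "{x. (\<Sum>i=1..n. x i) \<in> {0}} \<inter> topspace (gl_space n) = sl_hyperplane n"
    by (auto simp: sl_hyperplane_def)
  then show ?thesis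
    unfolding slice_def sl_space_def by (metis Int_commute subtopology_restrict)
qed

lemma seg_simps [simp]:
  "i \<in> {1..n} \<Longrightarrow> seg n x y t i = x i + t * (y i - x i)"
  "x \<in> extensional {1..n} \<Longrightarrow> seg n x y 0 = x"
  "y \<in> extensional {1..n} \<Longrightarrow> seg n x y 1 = y"
  "seg n x y t \<in> extensional {1..n}"
  by (auto simp: seg_def extensional_def fun_eq_iff)

lemma sum_seg: "(\<Sum>i=1..n. seg n x y t i) = (\<Sum>i=1..n. x i) + t * ((\<Sum>i=1..n. y i) - (\<Sum>i=1..n. x i))"
  by (simp add: sum.distrib sum_subtractf flip: sum_distrib_left)

lemma seg_in_slice:
  assumes "convex U" "x \<in> topspace (slice n U)" "y \<in> topspace (slice n U)" "t \<in> {0..1}"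
  shows "seg n x y t \<in> topspace (slice n U)"
proof -
  let ?a = "\<Sum>i=1..n. x i" and ?b = "\<Sum>i=1..n. y i"
  have "(1 - t) *\<^sub>R ?a + t *\<^sub>R ?b \<in> U"
    using assms convexD[of U ?a ?b "1 - t" t] by (auto simp: topspace_slice)
  then have "?a + t * (?b - ?a) \<in> U"
    by (simp add: algebra_simps)
  then show ?thesis
    unfolding topspace_slice mem_Collect_eq sum_seg by simp
qed

lemma continuous_map_seg:
  assumes "\<And>t. t \<in> I \<Longrightarrow> seg n x y t \<in> topspace (slice n U)"
  shows "continuous_map (top_of_set I) (slice n U) (seg n x y)"
  unfolding slice_def continuous_map_in_subtopology
proof
  show "continuous_map (top_of_set I) (gl_space n) (seg n x y)"
    unfolding gl_space_def continuous_map_componentwise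
  proof (intro conjI ballI)
    show "seg n x y ` topspace (top_of_set I) \<subseteq> extensional {1..n}"
      by (auto simp: seg_def)
    show "continuous_map (top_of_set I) euclideanreal (\<lambda>t. seg n x y t k)" if "k \<in> {1..n}" for k
      using that by (simp, intro continuous_intros)
  qed
  show "seg n x y \<in> topspace (top_of_set I) \<rightarrow> {x. (\<Sum>i=1..n. x i) \<in> U}"
    using assms by (auto simp: topspace_slice)
qed

lemma continuous_map_coordinate:
  "i \<in> {1..n} \<Longrightarrow> continuous_map (slice n U) euclideanreal (\<lambda>x. x i)"
  unfolding slice_def gl_space_def
  by (intro continuous_map_from_subtopology continuous_map_product_projection)

lemma openin_positive:
  assumes "finite P" "\<And>f. f \<in> P \<Longrightarrow> continuous_map X euclideanreal f"
  shows "openin X {x \<in> topspace X. \<forall>f\<in>P. f x > 0}"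
proof -
  have "openin X {x \<in> topspace X. f x \<in> {0<..}}" if "f \<in> P" for f
    using assms(2)[OF that] by (rule openin_continuous_map_preimage) simp
  then have "openin X ((\<Inter>f\<in>P. {x \<in> topspace X. f x \<in> {0<..}}) \<inter> topspace X)"
    using assms(1) by (intro openin_INT) auto
  moreover have "(\<Inter>f\<in>P. {x \<in> topspace X. f x \<in> {0<..}}) \<inter> topspace X
      = {x \<in> topspace X. \<forall>f\<in>P. f x > 0}"
    by auto
  ultimately show ?thesis by simp
qed

lemma closedin_nonnegative:
  assumes "\<And>f. f \<in> P \<Longrightarrow> continuous_map X euclideanreal f"
  shows "closedin X {x \<in> topspace X. \<forall>f\<in>P. f x \<ge> 0}"
proof (cases "P = {}")
  case False
  have "closedin X {x \<in> topspace X. f x \<in> {0..}}" if "f \<in> P" for f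
    using assms[OF that] by (rule closedin_continuous_map_preimage) simp
  then have "closedin X (\<Inter>f\<in>P. {x \<in> topspace X. f x \<in> {0..}})"
    using False by (intro closedin_Inter) auto
  moreover have "(\<Inter>f\<in>P. {x \<in> topspace X. f x \<in> {0..}}) = {x \<in> topspace X. \<forall>f\<in>P. f x \<ge> 0}"
    using False by auto
  ultimately show ?thesis by simp
qed auto

definition affine_on_segs :: "nat \<Rightarrow> ((nat \<Rightarrow> real) \<Rightarrow> real) \<Rightarrow> bool" where
  "affine_on_segs n f \<longleftrightarrow> (\<forall>x y t. f (seg n x y t) = f x + t * (f y - f x))"

text \<open>
  The half-open segment from a point of the closed polyhedron to a point of the open cell lies in
  the open cell. This gives both the connectedness of the cell and its closure.
\<close>

lemma seg_in_cell:
  assumes aff: "affine_on_segs n f" and "f y \<ge> 0" "f x > 0" "t \<in> {0<..1}"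
  shows "f (seg n y x t) > 0"
proof -
  have "f (seg n y x t) = (1 - t) * f y + t * f x"
    using aff by (simp add: affine_on_segs_def algebra_simps)
  also have "\<dots> > 0"
    using assms by (intro add_nonneg_pos) auto
  finally show ?thesis .
qed

lemma connectedin_cell:
  assumes U: "convex U" and aff: "\<And>f. f \<in> P \<Longrightarrow> affine_on_segs n f"
  shows "connectedin (slice n U) {x \<in> topspace (slice n U). \<forall>f\<in>P. f x > 0}" (is "connectedin ?X ?K")
proof -
  have "\<exists>T. connectedin ?X T \<and> T \<subseteq> ?K \<and> x \<in> T \<and> y \<in> T" if x: "x \<in> ?K" and y: "y \<in> ?K" for x y
  proof (intro exI conjI)
    have sl: "seg n x y t \<in> topspace ?X" if "t \<in> {0..1}" for t
      using seg_in_slice[OF U] x y that by auto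
    have "continuous_map (top_of_set {0..1}) ?X (seg n x y)"
      using sl by (rule continuous_map_seg)
    moreover have "connectedin (top_of_set {0..1::real}) {0..1}"
      by (simp add: connectedin_subtopology)
    ultimately show "connectedin ?X (seg n x y ` {0..1})"
      by (rule connectedin_continuous_map_image)
    show "seg n x y ` {0..1} \<subseteq> ?K"
    proof clarsimp
      fix t :: real assume t: "0 \<le> t" "t \<le> 1"
      have "f (seg n x y t) > 0" if "f \<in> P" for f
      proof (cases "t = 0")
        case True
        with x that show ?thesis by (simp add: topspace_slice)
      next
        case False
        then show ?thesis
          using seg_in_cell[OF aff[OF that], of x y t] x y t that by fastforce
      qed
      then show "seg n x y t \<in> topspace ?X \<and> (\<forall>f\<in>P. 0 < f (seg n x y t))"
        using sl t by auto
    qed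
    have "seg n x y 0 = x" "seg n x y 1 = y"
      using x y by (auto simp: topspace_slice)
    then show "x \<in> seg n x y ` {0..1}" "y \<in> seg n x y ` {0..1}"
      by (metis atLeastAtMost_iff image_eqI order_refl zero_le_one)+
  qed
  then have "connected_space (subtopology ?X ?K)"
    unfolding connected_space_iff_connected_component connected_component_of_def
    by (auto simp: connectedin_subtopology)
  then show ?thesis
    by (auto simp: connectedin_def)
qed

text \<open>
  A point of the closed polyhedron is the limit of the points on the segment from it to a point of
  the open cell. When the cell is empty, the polyhedron can still have points, hence the last
  hypothesis.
\<close>

lemma closure_of_cell:
  assumes U: "convex U"
    and cont: "\<And>f. f \<in> P \<Longrightarrow> continuous_map (slice n U) euclideanreal f"
    and aff: "\<And>f. f \<in> P \<Longrightarrow> affine_on_segs n f"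
    and ne: "{x \<in> topspace (slice n U). \<forall>f\<in>P. f x > 0} \<noteq> {}"
  shows "slice n U closure_of {x \<in> topspace (slice n U). \<forall>f\<in>P. f x > 0}
    = {x \<in> topspace (slice n U). \<forall>f\<in>P. f x \<ge> 0}" (is "?X closure_of ?K = ?L")
proof
  show "?X closure_of ?K \<subseteq> ?L"
    by (rule closure_of_minimal[OF _ closedin_nonnegative[OF cont]]) (auto intro: less_imp_le)
  show "?L \<subseteq> ?X closure_of ?K"
  proof
    fix y assume y: "y \<in> ?L"
    obtain x where x: "x \<in> ?K" using ne by blast
    have sl: "seg n y x t \<in> topspace ?X" if "t \<in> {0..1}" for t
      using seg_in_slice[OF U] x y that by auto
    show "y \<in> ?X closure_of ?K"
      unfolding in_closure_of
    proof (intro conjI allI impI)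
      show "y \<in> topspace ?X" using y by simp
      fix T assume T: "y \<in> T \<and> openin ?X T"
      have "openin (top_of_set {0..1}) {t \<in> topspace (top_of_set {0..1}). seg n y x t \<in> T}"
        by (rule openin_continuous_map_preimage[OF continuous_map_seg]) (use sl T in auto)
      moreover have "0 \<in> {t \<in> topspace (top_of_set {0..1}). seg n y x t \<in> T}"
        using T y by (simp add: topspace_slice)
      ultimately obtain e where e: "e > 0" "\<And>t. t \<in> {0..1} \<Longrightarrow> dist t 0 < e \<Longrightarrow> seg n y x t \<in> T"
        unfolding openin_euclidean_subtopology_iff by force
      define t where "t = min 1 (e / 2)"
      have t: "t \<in> {0<..1}" "dist t 0 < e"
        using e(1) by (auto simp: t_def dist_real_def)
      have "seg n y x t \<in> ?K"
        using sl[of t] t seg_in_cell[OF aff] x y by auto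
      moreover have "seg n y x t \<in> T"
        using e(2) t by auto
      ultimately show "\<exists>z. z \<in> ?K \<and> z \<in> T" by blast
    qed
  qed
qed

section \<open>The interior of the dominant cone\<close>

lemma affine_on_segs_diff:
  "i \<in> {1..n} \<Longrightarrow> j \<in> {1..n} \<Longrightarrow> affine_on_segs n (\<lambda>x. x i - x j)"
  by (simp add: affine_on_segs_def algebra_simps)

lemma affine_on_segs_add:
  "i \<in> {1..n} \<Longrightarrow> j \<in> {1..n} \<Longrightarrow> affine_on_segs n (\<lambda>x. x i + x j)"
  by (simp add: affine_on_segs_def algebra_simps)

lemma affine_on_segs_uminus_add:
  "i \<in> {1..n} \<Longrightarrow> j \<in> {1..n} \<Longrightarrow> affine_on_segs n (\<lambda>x. - (x i + x j))"
  by (simp add: affine_on_segs_def algebra_simps)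

definition gaps :: "nat \<Rightarrow> ((nat \<Rightarrow> real) \<Rightarrow> real) set" where
  "gaps n = (\<lambda>(i, j) x. x i - x j) ` {(i, j). i \<in> {1..n} \<and> j \<in> {1..n} \<and> i < j}"

lemma finite_gaps: "finite (gaps n)"
  unfolding gaps_def by (intro finite_imageI finite_subset[OF _ finite_cartesian_product[of "{1..n}" "{1..n}"]]) auto

lemma gaps_affine: "f \<in> gaps n \<Longrightarrow> affine_on_segs n f"
  by (auto simp: gaps_def intro!: affine_on_segs_diff)

lemma gaps_continuous: "f \<in> gaps n \<Longrightarrow> continuous_map (slice n U) euclideanreal f"
  by (auto simp: gaps_def intro!: continuous_map_diff continuous_map_coordinate)

lemma gaps_pos_iff: "(\<forall>f\<in>gaps n. f x > 0) \<longleftrightarrow> strict_antimono_on {1..n} x"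
  by (fastforce simp: gaps_def monotone_on_def)

lemma gaps_nonneg_iff: "(\<forall>f\<in>gaps n. f x \<ge> 0) \<longleftrightarrow> antimono_on {1..n} x"
proof
  assume L: "\<forall>f\<in>gaps n. f x \<ge> 0"
  show "antimono_on {1..n} x"
  proof (rule monotone_onI)
    fix i j assume "i \<in> {1..n}" "j \<in> {1..n}" "i \<le> j"
    moreover from this have "i < j \<Longrightarrow> (\<lambda>x. x i - x j) \<in> gaps n"
      unfolding gaps_def by (intro image_eqI[of _ _ "(i, j)"]) auto
    ultimately show "x j \<le> x i"
      using bspec[OF L, of "\<lambda>x. x i - x j"] by (cases "i = j") auto
  qed
qed (fastforce simp: gaps_def monotone_on_def)

text \<open>
  At a dominant point with \<open>x i = x j\<close>, \<open>i < j\<close>, moving in the direction \<open>e\<^sub>j - e\<^sub>i\<close> keeps the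
  coordinate sum, hence stays in every slice, and leaves the cone at once.
\<close>

lemma interior_weyl_chamber:
  "slice n U interior_of (weyl_chamber n \<inter> topspace (slice n U))
    = {x \<in> topspace (slice n U). strict_antimono_on {1..n} x}" (is "?X interior_of ?W = ?K")
proof
  have "openin ?X ?K"
    using openin_positive[OF finite_gaps gaps_continuous] by (simp add: gaps_pos_iff)
  moreover have "?K \<subseteq> ?W"
    by (auto simp: weyl_chamber_def topspace_slice topspace_gl_space strict_antimono_iff_antimono)
  ultimately show "?K \<subseteq> ?X interior_of ?W"
    by (simp add: interior_of_maximal)
  show "?X interior_of ?W \<subseteq> ?K"
  proof
    fix x assume "x \<in> ?X interior_of ?W"
    then obtain T where T: "openin ?X T" "x \<in> T" "T \<subseteq> ?W"
      by (auto simp: interior_of_def)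
    have x: "x \<in> topspace ?X" "antimono_on {1..n} x"
      using T by (auto simp: weyl_chamber_def)
    have "x j < x i" if ij: "i \<in> {1..n}" "j \<in> {1..n}" "i < j" for i j
    proof (rule ccontr)
      assume "\<not> x j < x i"
      then have eq: "x i = x j"
        using monotone_onD[OF x(2) ij(1,2)] ij(3) by simp
      define y where "y = (\<lambda>l\<in>{1..n}. x l + ((if l = j then 1 else 0) - (if l = i then 1 else 0)))"
      have y: "y \<in> extensional {1..n}" "(\<Sum>l=1..n. y l) = (\<Sum>l=1..n. x l)"
        using ij by (auto simp: y_def sum.distrib sum_subtractf sum.delta)
      have sl: "seg n x y t \<in> topspace ?X" for t
        using x(1) y(2) unfolding topspace_slice mem_Collect_eq sum_seg by simp
      have "openin (top_of_set UNIV) {t \<in> topspace (top_of_set UNIV). seg n x y t \<in> T}"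
        by (rule openin_continuous_map_preimage[OF continuous_map_seg]) (use sl T in auto)
      moreover have "0 \<in> {t \<in> topspace (top_of_set UNIV). seg n x y t \<in> T}"
        using T x by (simp add: topspace_slice)
      ultimately obtain e where e: "e > 0" "\<And>t. dist t 0 < e \<Longrightarrow> seg n x y t \<in> T"
        unfolding openin_euclidean_subtopology_iff by force
      have "seg n x y (e / 2) \<in> ?W"
        using e T by (auto simp: dist_real_def)
      then have "antimono_on {1..n} (seg n x y (e / 2))"
        by (simp add: weyl_chamber_def)
      from monotone_onD[OF this ij(1,2)] have "seg n x y (e / 2) j \<le> seg n x y (e / 2) i"
        using ij(3) by simp
      then show False
        using ij eq e(1) by (simp add: y_def)
    qed
    then show "x \<in> ?K"
      using x by (auto intro: monotone_onI)
  qed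
qed

section \<open>The decreasing enumeration of a finite set of naturals\<close>

lemma initial_segment:
  fixes A :: "nat set"
  assumes "finite A" "\<And>a. a \<in> A \<Longrightarrow> i \<le> a" "\<And>a b. a \<in> A \<Longrightarrow> i \<le> b \<Longrightarrow> b \<le> a \<Longrightarrow> b \<in> A"
  shows "A = {i..<i + card A}"
proof (cases "A = {}")
  case False
  define m where "m = Max A"
  have m: "m \<in> A" "\<And>a. a \<in> A \<Longrightarrow> a \<le> m"
    using assms(1) False by (simp_all add: m_def)
  have "i \<le> m"
    using assms(2) m(1) .
  have eq: "A = {i..m}"
  proof
    show "A \<subseteq> {i..m}"
      using assms(2) m(2) by (meson atLeastAtMost_iff subsetI)
    show "{i..m} \<subseteq> A"
      using assms(3)[OF m(1)] by (meson atLeastAtMost_iff subsetI)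
  qed
  show ?thesis
    unfolding eq using \<open>i \<le> m\<close> by auto
qed simp

text \<open>
  The values \<open>a\<^sub>i\<close> of a set are read off from any formula that lists it in decreasing order, because
  the sorted list with a given set of elements is unique.
\<close>

lemma desc_image:
  fixes f :: "nat \<Rightarrow> nat"
  assumes f: "strict_antimono_on {1..k} f"
  shows "card (f ` {1..k}) = k" and "i \<in> {1..k} \<Longrightarrow> desc (f ` {1..k}) i = f i"
proof -
  have inj: "inj_on f {1..k}"
    using f by (simp add: strict_antimono_iff_antimono)
  then show card: "card (f ` {1..k}) = k"
    by (simp add: card_image)
  let ?l = "map f [1..<Suc k]"
  have "sorted_wrt (\<lambda>x y. y < x) ?l"
    using f by (auto simp: sorted_wrt_iff_nth_less monotone_on_def simp del: upt_Suc)
  then have "sorted_wrt (<) (rev ?l)"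
    by (simp only: sorted_wrt_rev)
  moreover have "set (rev ?l) = f ` {1..k}"
    by auto
  ultimately have "sorted_list_of_set (f ` {1..k}) = rev ?l"
    by (metis sorted_list_of_set.idem_if_sorted_distinct strict_sorted_iff)
  then show "desc (f ` {1..k}) i = f i" if "i \<in> {1..k}"
    using that card by (auto simp: desc_def simp del: upt_Suc)
qed

lemma rev_sorted_list_enumeration:
  fixes S :: "'a::linorder set"
  assumes "finite S"
  defines "x \<equiv> \<lambda>i. rev (sorted_list_of_set S) ! (i - 1)"
  shows "strict_antimono_on {1..card S} x" and "x ` {1..card S} = S"
proof -
  let ?l = "rev (sorted_list_of_set S)"
  have sorted: "sorted_wrt (\<lambda>x y. y < x) ?l"
    using strict_sorted_list_of_set[of S] by (simp only: sorted_wrt_rev)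
  have len: "length ?l = card S"
    by simp
  show "strict_antimono_on {1..card S} x"
  proof (rule monotone_onI)
    fix i j assume ij: "i \<in> {1..card S}" "j \<in> {1..card S}" "i < j"
    then have "i - 1 < j - 1" "j - 1 < length ?l"
      by auto
    then show "x j < x i"
      unfolding x_def by (rule sorted_wrt_nth_less[OF sorted])
  qed
  have "S = set ?l"
    using assms by simp
  also have "\<dots> = (\<lambda>i. ?l ! i) ` {..<card S}"
    by (metis len set_conv_nth image_Collect lessThan_def Setcompr_eq_image)
  also have "{..<card S} = (\<lambda>i. i - 1) ` {1..card S}"
    by (auto simp: image_iff intro!: bexI[of _ "Suc _"])
  finally show "x ` {1..card S} = S"
    by (simp add: x_def image_image)
qed

lemma desc_enumeration:
  assumes "finite S"
  shows strict_antimono_desc: "strict_antimono_on {1..card S} (desc S)"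
    and desc_image_eq: "desc S ` {1..card S} = S"
proof -
  have desc: "desc S i = rev (sorted_list_of_set S) ! (i - 1)" if "i \<in> {1..card S}" for i
    using that by (simp add: desc_def)
  show "strict_antimono_on {1..card S} (desc S)"
    using rev_sorted_list_enumeration(1)[OF assms] by (simp add: monotone_on_def desc)
  show "desc S ` {1..card S} = S"
    using rev_sorted_list_enumeration(2)[OF assms] by (simp only: desc cong: image_cong)
qed

text \<open>
  Since the enumeration decreases, the indices with \<open>desc S i \<ge> t\<close> form an initial segment, whose
  length is the number of elements from \<open>t\<close> on. Conditions on the enumeration thus become conditions
  on numbers of elements above a threshold.
\<close>

lemma desc_ge_iff:
  assumes S: "finite S" and "i \<ge> 1" "t \<ge> 1"
  shows "t \<le> desc S i \<longleftrightarrow> i \<le> card (S \<inter> {t..})"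
proof -
  define A where "A = {j \<in> {1..card S}. t \<le> desc S j}"
  have "desc S ` A = desc S ` {1..card S} \<inter> {t..}"
    by (auto simp: A_def)
  then have "desc S ` A = S \<inter> {t..}"
    by (simp only: desc_image_eq[OF S])
  moreover have "inj_on (desc S) A"
    by (rule inj_on_subset[of _ "{1..card S}"])
       (use strict_antimono_desc[OF S] in \<open>auto simp: strict_antimono_iff_antimono A_def\<close>)
  ultimately have card_eq: "card (S \<inter> {t..}) = card A"
    by (metis card_image)
  have "A = {1..<1 + card A}"
  proof (rule initial_segment)
    fix a b assume a: "a \<in> A" and b: "1 \<le> b" "b \<le> a"
    then have "desc S a \<le> desc S b"
      using monotone_onD[OF strict_antimono_desc[OF S], of b a]
      by (cases "a = b") (auto simp: A_def)
    then show "b \<in> A"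
      using a b by (auto simp: A_def)
  qed (auto simp: A_def)
  then have "i \<in> A \<longleftrightarrow> i \<in> {1..<1 + card A}"
    by (rule arg_cong[where f = "\<lambda>B. i \<in> B"])
  then have "i \<in> A \<longleftrightarrow> i \<le> card A"
    using \<open>i \<ge> 1\<close> by (simp add: less_Suc_eq_le plus_1_eq_Suc)
  moreover have "t \<le> desc S i \<longleftrightarrow> i \<in> A"
    using \<open>i \<ge> 1\<close> \<open>t \<ge> 1\<close> by (auto simp: A_def desc_def split: if_splits)
  ultimately show ?thesis
    by (simp only: card_eq)
qed

section \<open>The sign cells of the arrangement\<close>

definition generic :: "nat \<Rightarrow> (nat \<Rightarrow> real) set" where
  "generic n = {x \<in> extensional {1..n}. strict_antimono_on {1..n} x
     \<and> (\<forall>i j. 1 \<le> i \<and> i \<le> j \<and> j \<le> n \<longrightarrow> x i + x j \<noteq> 0)}"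

definition open_cell :: "nat \<Rightarrow> nat set \<Rightarrow> (nat \<Rightarrow> real) set" where
  "open_cell n S = {x \<in> extensional {1..n}. strict_antimono_on {1..n} x
     \<and> (\<forall>i j. 1 \<le> i \<and> i \<le> j \<and> j \<le> n \<longrightarrow>
          (if i \<le> card S \<and> j \<le> desc S i + i - 1 then x i + x j > 0 else x i + x j < 0))}"

text \<open>
  At a generic point with \<open>x\<^sub>i > 0\<close> the number of \<open>j \<ge> i\<close> with \<open>x\<^sub>i + x\<^sub>j > 0\<close> is the rank of \<open>x\<^sub>i\<close> among all absolute
  values. So the set \<open>S\<close> of a cell records which ranks belong to positive coordinates.
\<close>

definition positive_ranks :: "nat \<Rightarrow> (nat \<Rightarrow> real) \<Rightarrow> nat set" where
  "positive_ranks n x = (\<lambda>i. card {j \<in> {i..n}. x i + x j > 0}) ` {i \<in> {1..n}. x i > 0}"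

lemma positive_ranks_subset: "positive_ranks n x \<subseteq> {1..n}"
proof
  fix m assume "m \<in> positive_ranks n x"
  then obtain i where i: "i \<in> {1..n}" "x i > 0" "m = card {j \<in> {i..n}. x i + x j > 0}"
    by (auto simp: positive_ranks_def)
  then have "i \<in> {j \<in> {i..n}. x i + x j > 0}"
    by simp
  then have "m > 0"
    unfolding i(3) by (subst card_gt_0_iff) auto
  moreover have "m \<le> card {i..n}"
    unfolding i(3) by (intro card_mono) auto
  ultimately show "m \<in> {1..n}"
    using i(1) by auto
qed

lemma genericD:
  assumes "x \<in> generic n"
  shows "strict_antimono_on {1..n} x"
    and "\<And>i j. 1 \<le> i \<Longrightarrow> i \<le> j \<Longrightarrow> j \<le> n \<Longrightarrow> x i + x j \<noteq> 0"
    and "x \<in> extensional {1..n}"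
proof -
  have *: "x \<in> extensional {1..n} \<and> strict_antimono_on {1..n} x
      \<and> (\<forall>i j. 1 \<le> i \<and> i \<le> j \<and> j \<le> n \<longrightarrow> x i + x j \<noteq> 0)"
    using assms unfolding generic_def mem_Collect_eq .
  show "strict_antimono_on {1..n} x"
    by (rule conjunct1[OF conjunct2[OF *]])
  show "x i + x j \<noteq> 0" if "1 \<le> i" "i \<le> j" "j \<le> n" for i j
    using that by (intro conjunct2[OF conjunct2[OF *], rule_format] conjI)
  show "x \<in> extensional {1..n}"
    by (rule conjunct1[OF *])
qed

lemma open_cellD:
  assumes "x \<in> open_cell n S"
  shows "strict_antimono_on {1..n} x"
    and "\<And>i j. 1 \<le> i \<Longrightarrow> i \<le> j \<Longrightarrow> j \<le> n \<Longrightarrow>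
      if i \<le> card S \<and> j \<le> desc S i + i - 1 then x i + x j > 0 else x i + x j < 0"
    and "x \<in> extensional {1..n}"
proof -
  note * = assms[unfolded open_cell_def mem_Collect_eq]
  show "strict_antimono_on {1..n} x"
    by (rule conjunct1[OF conjunct2[OF *]])
  show "if i \<le> card S \<and> j \<le> desc S i + i - 1 then x i + x j > 0 else x i + x j < 0"
    if "1 \<le> i" "i \<le> j" "j \<le> n" for i j
    using that by (intro conjunct2[OF conjunct2[OF *], rule_format] conjI)
  show "x \<in> extensional {1..n}"
    by (rule conjunct1[OF *])
qed

lemma genericI:
  assumes "x \<in> extensional {1..n}" "strict_antimono_on {1..n} x"
    and "\<And>i j. 1 \<le> i \<Longrightarrow> i \<le> j \<Longrightarrow> j \<le> n \<Longrightarrow> x i + x j \<noteq> 0"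
  shows "x \<in> generic n"
  unfolding generic_def mem_Collect_eq by (intro conjI allI impI assms) (elim conjE, assumption)+

lemma open_cellI:
  assumes "x \<in> extensional {1..n}" "strict_antimono_on {1..n} x"
    and "\<And>i j. 1 \<le> i \<Longrightarrow> i \<le> j \<Longrightarrow> j \<le> n \<Longrightarrow>
      if i \<le> card S \<and> j \<le> desc S i + i - 1 then x i + x j > 0 else x i + x j < 0"
  shows "x \<in> open_cell n S"
  unfolding open_cell_def mem_Collect_eq by (intro conjI allI impI assms) (elim conjE, assumption)+

lemma open_cell_subset_generic: "open_cell n S \<subseteq> generic n"
proof
  fix x assume x: "x \<in> open_cell n S"
  have "x i + x j \<noteq> 0" if "1 \<le> i" "i \<le> j" "j \<le> n" for i j
    using open_cellD(2)[OF x that] by (metis less_irrefl)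
  then show "x \<in> generic n"
    using open_cellD(1,3)[OF x] by (intro genericI)
qed

lemma positives_initial:
  assumes "strict_antimono_on {1..n} x"
  shows "{i \<in> {1..n}. x i > (0::real)} = {1..card {i \<in> {1..n}. x i > 0}}"
proof -
  let ?A = "{i \<in> {1..n}. x i > 0}"
  have "?A = {1..<1 + card ?A}"
  proof (rule initial_segment)
    fix a b assume "a \<in> ?A" "1 \<le> b" "b \<le> a"
    then show "b \<in> ?A"
      using monotone_onD[OF assms, of b a] by (cases "b = a") auto
  qed auto
  then show ?thesis
    by (metis atLeastLessThanSuc_atLeastAtMost plus_1_eq_Suc)
qed

text \<open>
  For \<open>x\<^sub>i > 0\<close> the indices \<open>j \<ge> i\<close> with \<open>x\<^sub>i + x\<^sub>j > 0\<close> form an interval starting at \<open>i\<close>, because \<open>x\<close>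
  decreases. Its length is the rank \<open>a\<^sub>i\<close>, so it ends at \<open>a\<^sub>i + i - 1\<close>, the bound in the definition
  of the cell. These intervals shrink strictly as \<open>i\<close> grows, hence \<open>a\<^sub>1 > a\<^sub>2 > \<dots>\<close> is the decreasing
  enumeration of the positive ranks.
\<close>

lemma generic_in_open_cell:
  assumes "x \<in> generic n"
  shows "x \<in> open_cell n (positive_ranks n x)"
proof -
  note anti = genericD(1)[OF assms] and nz = genericD(2)[OF assms] and ext = genericD(3)[OF assms]
  define k where "k = card {i \<in> {1..n}. x i > 0}"
  define M where "M i = {j \<in> {i..n}. x i + x j > 0}" for i
  have pos: "{i \<in> {1..n}. x i > 0} = {1..k}"
    unfolding k_def by (rule positives_initial[OF anti])
  have fin: "finite (M i)" for i
    by (simp add: M_def)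
  have ranks: "positive_ranks n x = (\<lambda>i. card (M i)) ` {1..k}"
    unfolding positive_ranks_def pos M_def ..
  have "strict_antimono_on {1..k} (\<lambda>i. card (M i))"
  proof (rule monotone_onI)
    fix i j assume ij: "i \<in> {1..k}" "j \<in> {1..k}" "i < j"
    then have in_pos: "i \<in> {i \<in> {1..n}. x i > 0}" "j \<in> {i \<in> {1..n}. x i > 0}"
      unfolding pos by auto
    have "M j \<subset> M i"
    proof
      have "x j < x i"
        using monotone_onD[OF anti, of i j] in_pos ij by auto
      then show "M j \<subseteq> M i"
        using ij by (auto simp: M_def)
      have "i \<in> M i" "i \<notin> M j"
        using in_pos ij by (auto simp: M_def)
      then show "M j \<noteq> M i" by blast
    qed
    then show "card (M j) < card (M i)"
      using fin psubset_card_mono by blast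
  qed
  from desc_image[OF this]
  have card: "card (positive_ranks n x) = k"
    and desc: "\<And>i. i \<in> {1..k} \<Longrightarrow> desc (positive_ranks n x) i = card (M i)"
    by (simp_all add: ranks)
  have "if i \<le> k \<and> j \<le> desc (positive_ranks n x) i + i - 1 then x i + x j > 0 else x i + x j < 0"
    if ij: "1 \<le> i" "i \<le> j" "j \<le> n" for i j
  proof (cases "i \<le> k")
    case True
    then have i: "i \<in> {1..k}" using ij by simp
    have "M i = {i..<i + card (M i)}"
    proof (rule initial_segment[OF fin])
      fix a b assume ab: "a \<in> M i" "i \<le> b" "b \<le> a"
      have "x b \<ge> x a"
        using monotone_onD[OF anti, of b a] ab ij by (cases "a = b") (auto simp: M_def)
      then show "b \<in> M i"
        using ab by (auto simp: M_def)
    qed (simp add: M_def)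
    then have "j \<in> M i \<longleftrightarrow> j < i + card (M i)"
      using ij by (metis atLeastLessThan_iff)
    moreover have "i \<in> M i"
      using i ij unfolding pos[symmetric] by (auto simp: M_def)
    then have "card (M i) > 0"
      using fin card_gt_0_iff by blast
    ultimately have "x i + x j > 0 \<longleftrightarrow> j \<le> desc (positive_ranks n x) i + i - 1"
      using ij by (auto simp: desc[OF i] M_def)
    then show ?thesis
      using True nz[OF ij] by auto
  next
    case False
    then have "i \<notin> {i \<in> {1..n}. x i > 0}"
      unfolding pos by auto
    then have "x i \<le> 0" using ij by auto
    moreover have "x j \<le> x i"
      using monotone_onD[OF anti, of i j] ij by (cases "i = j") auto
    ultimately show ?thesis
      using False nz[OF ij] by auto
  qed
  then show ?thesis
    using ext anti unfolding card[symmetric] by (intro open_cellI)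
qed

text \<open>
  The inequalities of the cell fix the numbers that are counted in the positive ranks. The bound
  \<open>a\<^sub>i + i - 1\<close> does not exceed \<open>n\<close>, since \<open>i\<close> elements of \<open>S\<close> lie between \<open>a\<^sub>i\<close> and \<open>n\<close>, so that
  the count is exactly \<open>a\<^sub>i\<close>.
\<close>

lemma positive_ranks_open_cell:
  assumes S: "S \<subseteq> {1..n}" and x: "x \<in> open_cell n S"
  shows "positive_ranks n x = S"
proof -
  have finS: "finite S"
    using S finite_subset by blast
  have cond: "if i \<le> card S \<and> j \<le> desc S i + i - 1 then x i + x j > 0 else x i + x j < 0"
    if "1 \<le> i" "i \<le> j" "j \<le> n" for i j
    using open_cellD(2)[OF x that] .
  have desc_S: "desc S i \<in> S" if "i \<in> {1..card S}" for i
    using desc_image_eq[OF finS] that by blast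
  have card_le: "card S \<le> n"
    using card_mono[OF _ S] by simp
  have desc_le: "desc S i + i \<le> n + 1" if i: "i \<in> {1..card S}" for i
  proof -
    have "i \<le> card (S \<inter> {desc S i..})"
      using desc_ge_iff[OF finS, of i "desc S i"] desc_S[OF i] S i by auto
    also have "\<dots> \<le> card {desc S i..n}"
      using S by (intro card_mono) auto
    finally show ?thesis
      using desc_S[OF i] S i by auto
  qed
  have pos: "{i \<in> {1..n}. x i > 0} = {1..card S}"
  proof -
    have "x i > 0 \<longleftrightarrow> i \<le> card S" if i: "i \<in> {1..n}" for i
    proof (cases "i \<le> card S")
      case True
      then have "desc S i \<ge> 1"
        using desc_S[of i] S i by auto
      then have "i \<le> desc S i + i - 1"
        by simp
      then show ?thesis
        using cond[of i i] True i by (simp split: if_splits)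
    next
      case False
      then show ?thesis
        using cond[of i i] i by auto
    qed
    then show ?thesis
      using card_le by auto
  qed
  have "card {j \<in> {i..n}. x i + x j > 0} = desc S i" if i: "i \<in> {1..card S}" for i
  proof -
    have "desc S i \<ge> 1"
      using desc_S[OF i] S by auto
    have "x i + x j > 0 \<longleftrightarrow> j \<le> desc S i + i - 1" if "j \<in> {i..n}" for j
    proof (cases "j \<le> desc S i + i - 1")
      case True
      then show ?thesis
        using cond[of i j] i that by simp
    next
      case False
      then have "x i + x j < 0"
        using cond[of i j] i that by simp
      then show ?thesis
        using False by simp
    qed
    then have "{j \<in> {i..n}. x i + x j > 0} = {j \<in> {i..n}. j \<le> desc S i + i - 1}"
      by auto
    also have "\<dots> = {i..<i + desc S i}"
      using \<open>desc S i \<ge> 1\<close> desc_le[OF i] by auto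
    finally have "{j \<in> {i..n}. x i + x j > 0} = {i..<i + desc S i}" .
    then show ?thesis by simp
  qed
  then have "positive_ranks n x = desc S ` {1..card S}"
    unfolding positive_ranks_def pos by (rule image_cong[OF refl])
  then show ?thesis
    by (simp only: desc_image_eq[OF finS])
qed

lemma generic_eq_Union_cells: "generic n = (\<Union>S\<in>Pow {1..n}. open_cell n S)"
proof
  show "generic n \<subseteq> (\<Union>S\<in>Pow {1..n}. open_cell n S)"
  proof
    fix x assume "x \<in> generic n"
    then show "x \<in> (\<Union>S\<in>Pow {1..n}. open_cell n S)"
      by (intro UN_I[of "positive_ranks n x"] PowI positive_ranks_subset generic_in_open_cell)
  qed
  show "(\<Union>S\<in>Pow {1..n}. open_cell n S) \<subseteq> generic n"
    by (intro UN_least open_cell_subset_generic)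
qed

lemma open_cells_disjoint:
  "S \<subseteq> {1..n} \<Longrightarrow> T \<subseteq> {1..n} \<Longrightarrow> S \<noteq> T \<Longrightarrow> open_cell n S \<inter> open_cell n T = {}"
  using positive_ranks_open_cell[of S n] positive_ranks_open_cell[of T n]
  by (metis disjoint_iff)

lemma generic_in_chamber_of:
  assumes "x \<in> generic n" "x \<in> chamber_of n S"
  shows "x \<in> open_cell n S"
proof -
  have "if i \<le> card S \<and> j \<le> desc S i + i - 1 then x i + x j > 0 else x i + x j < 0"
    if "1 \<le> i" "i \<le> j" "j \<le> n" for i j
  proof -
    have "x i + x j \<noteq> 0"
      using genericD(2)[OF assms(1) that] .
    moreover have "if i \<le> card S \<and> j \<le> desc S i + i - 1 then x i + x j \<ge> 0 else x i + x j \<le> 0"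
      using assms(2) that by (simp add: chamber_of_def)
    ultimately show ?thesis
      by (auto split: if_splits)
  qed
  then show ?thesis
    using genericD(1,3)[OF assms(1)] by (intro open_cellI)
qed

section \<open>Chambers as closures of cells\<close>

text \<open>
  The sums \<open>x\<^sub>i + x\<^sub>j\<close> with the signs that make them positive on the cell of \<open>S\<close>; together with the
  gaps they present the cell as an open polyhedron.
\<close>

definition signed_sums :: "nat \<Rightarrow> nat set \<Rightarrow> ((nat \<Rightarrow> real) \<Rightarrow> real) set" where
  "signed_sums n S = (\<lambda>(i, j) x. if i \<le> card S \<and> j \<le> desc S i + i - 1 then x i + x j else - (x i + x j))
     ` {(i, j). 1 \<le> i \<and> i \<le> j \<and> j \<le> n}"

lemma finite_signed_sums: "finite (signed_sums n S)"
proof -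
  have "{(i, j). 1 \<le> i \<and> i \<le> j \<and> j \<le> n} \<subseteq> {1..n} \<times> {1..n}"
    by auto
  then show ?thesis
    unfolding signed_sums_def by (intro finite_imageI) (rule finite_subset, auto)
qed

lemma signed_sums_cases:
  assumes "f \<in> signed_sums n S"
  obtains i j where "i \<in> {1..n}" "j \<in> {1..n}" "f = (\<lambda>x. x i + x j) \<or> f = (\<lambda>x. - (x i + x j))"
proof -
  obtain i j where ij: "1 \<le> i" "i \<le> j" "j \<le> n"
    and f: "f = (\<lambda>x. if i \<le> card S \<and> j \<le> desc S i + i - 1 then x i + x j else - (x i + x j))"
    using assms unfolding signed_sums_def by auto
  show ?thesis
  proof (rule that)
    show "i \<in> {1..n}" "j \<in> {1..n}" using ij by auto
    show "f = (\<lambda>x. x i + x j) \<or> f = (\<lambda>x. - (x i + x j))"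
    proof (cases "i \<le> card S \<and> j \<le> desc S i + i - 1")
      case True
      show ?thesis unfolding f if_P[OF True] by simp
    next
      case False
      show ?thesis unfolding f if_not_P[OF False] by simp
    qed
  qed
qed

lemma signed_sums_affine: "f \<in> signed_sums n S \<Longrightarrow> affine_on_segs n f"
  by (erule signed_sums_cases, elim disjE)
     (simp_all only: affine_on_segs_add affine_on_segs_uminus_add)

lemma signed_sums_continuous:
  "f \<in> signed_sums n S \<Longrightarrow> continuous_map (slice n U) euclideanreal f"
  by (erule signed_sums_cases, elim disjE)
     (simp_all only:, (intro continuous_map_minus continuous_map_add continuous_map_coordinate; assumption)+)

lemma ball_signed_sums:
  "(\<forall>f\<in>signed_sums n S. P (f x)) \<longleftrightarrow> (\<forall>i j. 1 \<le> i \<and> i \<le> j \<and> j \<le> n \<longrightarrow>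
     (if i \<le> card S \<and> j \<le> desc S i + i - 1 then P (x i + x j) else P (- (x i + x j))))"
  unfolding signed_sums_def by (simp add: if_distrib cong: if_cong)

lemma open_cell_eq:
  "open_cell n S \<inter> topspace (slice n U)
    = {x \<in> topspace (slice n U). \<forall>f\<in>gaps n \<union> signed_sums n S. f x > 0}"
proof -
  have "x \<in> open_cell n S \<longleftrightarrow> (\<forall>f\<in>gaps n \<union> signed_sums n S. f x > 0)"
    if "x \<in> topspace (slice n U)" for x
  proof -
    have "x \<in> extensional {1..n}"
      using that by (simp add: topspace_slice)
    moreover have "(\<forall>f\<in>signed_sums n S. f x > 0) \<longleftrightarrow> (\<forall>i j. 1 \<le> i \<and> i \<le> j \<and> j \<le> n \<longrightarrow>
        (if i \<le> card S \<and> j \<le> desc S i + i - 1 then x i + x j > 0 else x i + x j < 0))"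
      unfolding ball_signed_sums[where P = "\<lambda>r. r > 0"] neg_0_less_iff_less ..
    ultimately show ?thesis
      unfolding ball_Un gaps_pos_iff open_cell_def mem_Collect_eq by simp
  qed
  then show ?thesis
    by auto
qed

lemma chamber_of_eq:
  "chamber_of n S \<inter> topspace (slice n U)
    = {x \<in> topspace (slice n U). \<forall>f\<in>gaps n \<union> signed_sums n S. f x \<ge> 0}"
proof -
  have "x \<in> chamber_of n S \<longleftrightarrow> (\<forall>f\<in>gaps n \<union> signed_sums n S. f x \<ge> 0)"
    if "x \<in> topspace (slice n U)" for x
  proof -
    have "x \<in> extensional {1..n}"
      using that by (simp add: topspace_slice)
    moreover have "(\<forall>f\<in>signed_sums n S. f x \<ge> 0) \<longleftrightarrow> (\<forall>i j. 1 \<le> i \<and> i \<le> j \<and> j \<le> n \<longrightarrow>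
        (if i \<le> card S \<and> j \<le> desc S i + i - 1 then x i + x j \<ge> 0 else x i + x j \<le> 0))"
      unfolding ball_signed_sums[where P = "\<lambda>r. r \<ge> 0"] neg_0_le_iff_le ..
    ultimately show ?thesis
      unfolding ball_Un gaps_nonneg_iff chamber_of_def weyl_chamber_def mem_Collect_eq
        topspace_gl_space by simp
  qed
  then show ?thesis
    by auto
qed

lemma open_cell_openin: "openin (slice n U) (open_cell n S \<inter> topspace (slice n U))"
  unfolding open_cell_eq
  by (rule openin_positive) (auto intro: finite_gaps finite_signed_sums gaps_continuous signed_sums_continuous)

lemma open_cell_connectedin:
  "convex U \<Longrightarrow> connectedin (slice n U) (open_cell n S \<inter> topspace (slice n U))"
  unfolding open_cell_eq by (rule connectedin_cell) (auto intro: gaps_affine signed_sums_affine)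

lemma closure_of_open_cell:
  assumes "convex U" "open_cell n S \<inter> topspace (slice n U) \<noteq> {}"
  shows "slice n U closure_of (open_cell n S \<inter> topspace (slice n U))
    = chamber_of n S \<inter> topspace (slice n U)"
  unfolding open_cell_eq chamber_of_eq
proof (rule closure_of_cell[OF assms(1)])
  fix f assume "f \<in> gaps n \<union> signed_sums n S"
  then show "continuous_map (slice n U) euclideanreal f" "affine_on_segs n f"
    by (meson UnE gaps_continuous signed_sums_continuous gaps_affine signed_sums_affine)+
qed (use assms(2)[unfolded open_cell_eq] in assumption)

lemma in_weights_iff:
  "w \<in> weights n \<longleftrightarrow> (\<exists>i. w = (\<lambda>x. x i) \<and> 1 \<le> i \<and> i \<le> n)
     \<or> (\<exists>i j. w = (\<lambda>x. x i + x j) \<and> 1 \<le> i \<and> i < j \<and> j \<le> n)"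
  by (simp only: weights_def Un_iff mem_Collect_eq)

text \<open>
  The hypothesis says that no weight vanishes identically on the slice; the weight \<open>x\<^sub>i\<close> appears as
  half of \<open>x\<^sub>i + x\<^sub>i\<close>.
\<close>

lemma regular_points_slice:
  assumes nz: "\<And>i j. 1 \<le> i \<Longrightarrow> i \<le> j \<Longrightarrow> j \<le> n \<Longrightarrow> \<exists>y\<in>topspace (slice n U). y i + y j \<noteq> 0"
  shows "regular_points n (slice n U) = generic n \<inter> topspace (slice n U)"
proof -
  let ?X = "slice n U"
  have "(\<forall>w\<in>weights n. (\<exists>y\<in>topspace ?X. w y \<noteq> 0) \<longrightarrow> w x \<noteq> 0)
      \<longleftrightarrow> (\<forall>i j. 1 \<le> i \<and> i \<le> j \<and> j \<le> n \<longrightarrow> x i + x j \<noteq> 0)" (is "?L \<longleftrightarrow> ?R") for x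
  proof
    assume L: ?L
    have "x i + x j \<noteq> 0" if ij: "1 \<le> i" "i \<le> j" "j \<le> n" for i j
    proof (cases "i = j")
      case True
      have "(\<lambda>x. x i) \<in> weights n"
        unfolding in_weights_iff using ij True by (intro disjI1 exI[of _ i]) simp
      moreover have "\<exists>y\<in>topspace ?X. y i \<noteq> 0"
        using nz[OF ij] True by auto
      ultimately have "x i \<noteq> 0"
        using bspec[OF L] by blast
      then show ?thesis
        using True by simp
    next
      case False
      then have "i < j"
        using ij by simp
      then have "(\<lambda>x. x i + x j) \<in> weights n"
        unfolding in_weights_iff using ij by (intro disjI2 exI[of _ i] exI[of _ j]) simp
      with L have "(\<exists>y\<in>topspace ?X. y i + y j \<noteq> 0) \<longrightarrow> x i + x j \<noteq> 0"
        by (rule bspec)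
      then show ?thesis
        using nz[OF ij] by (rule mp)
    qed
    then show ?R by simp
  next
    assume R: ?R
    have "w x \<noteq> 0" if "w \<in> weights n" for w
    proof -
      consider i where "1 \<le> i" "i \<le> n" "w = (\<lambda>x. x i)"
        | i j where "1 \<le> i" "i < j" "j \<le> n" "w = (\<lambda>x. x i + x j)"
        using \<open>w \<in> weights n\<close> unfolding in_weights_iff by (elim disjE exE conjE)
      then show ?thesis
      proof cases
        case 1
        then have "x i + x i \<noteq> 0" using R[rule_format, of i i] by simp
        then show ?thesis using 1(3) by simp
      next
        case 2
        then show ?thesis using R[rule_format, of i j] by simp
      qed
    qed
    then show ?L by simp
  qed
  note weights_iff = this
  have "x \<in> regular_points n ?X \<longleftrightarrow> x \<in> generic n \<inter> topspace ?X" for x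
  proof -
    have absorb: "(t \<and> s) \<and> r \<longleftrightarrow> (e \<and> s \<and> r) \<and> t" if "t \<Longrightarrow> e" for t s r e :: bool
      using that by blast
    show ?thesis
      unfolding regular_points_def interior_weyl_chamber mem_Collect_eq weights_iff
        generic_def Int_iff
      by (rule absorb) (simp add: topspace_slice)
  qed
  then show ?thesis
    by (rule set_eqI)
qed

lemma chambers_in_slice:
  assumes U: "convex U"
    and nz: "\<And>i j. 1 \<le> i \<Longrightarrow> i \<le> j \<Longrightarrow> j \<le> n \<Longrightarrow> \<exists>y\<in>topspace (slice n U). y i + y j \<noteq> 0"
  shows "chambers_in n (slice n U)
    = {chamber_of n S \<inter> topspace (slice n U) | S. S \<subseteq> {1..n} \<and> open_cell n S \<inter> topspace (slice n U) \<noteq> {}}"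
proof -
  let ?X = "slice n U"
  let ?K = "\<lambda>S. open_cell n S \<inter> topspace ?X"
  let ?I = "{S. S \<subseteq> {1..n} \<and> ?K S \<noteq> {}}"
  have "regular_points n ?X = generic n \<inter> topspace ?X"
    by (rule regular_points_slice) (rule nz)
  then have "regular_points n ?X = (\<Union>S\<in>Pow {1..n}. ?K S)"
    unfolding generic_eq_Union_cells by (simp only: UN_simps)
  moreover have "connected_components_of (subtopology ?X (\<Union>S\<in>Pow {1..n}. ?K S))
      = {?K S | S. S \<in> Pow {1..n} \<and> ?K S \<noteq> {}}"
  proof (rule connected_components_of_disjoint_open)
    fix S T assume "S \<in> Pow {1..n}" "T \<in> Pow {1..n}" "S \<noteq> T"
    then show "?K S \<inter> ?K T = {}"
      using open_cells_disjoint[of S n T] by blast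
  qed (rule open_cell_connectedin[OF U] open_cell_openin)+
  moreover have "{?K S | S. S \<in> Pow {1..n} \<and> ?K S \<noteq> {}} = ?K ` ?I"
    by (simp only: image_Collect Pow_iff)
  ultimately have "chambers_in n ?X = (\<lambda>S. ?X closure_of ?K S) ` ?I"
    unfolding chambers_in_def by (simp only: image_image)
  also have "\<dots> = (\<lambda>S. chamber_of n S \<inter> topspace ?X) ` ?I"
    using closure_of_open_cell[OF U] by (intro image_cong refl) simp
  finally show ?thesis
    by (simp only: image_Collect)
qed

lemma gl_chambers_eq: "gl_chambers n = {chamber_of n S | S. S \<subseteq> {1..n} \<and> open_cell n S \<noteq> {}}"
proof -
  have nz: "\<exists>y\<in>topspace (slice n UNIV). y i + y j \<noteq> 0" if "1 \<le> i" "i \<le> j" "j \<le> n" for i j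
    using that by (intro bexI[of _ "\<lambda>i\<in>{1..n}. 1"]) (auto simp: topspace_slice)
  have "gl_chambers n = {chamber_of n S \<inter> topspace (slice n UNIV) | S.
      S \<subseteq> {1..n} \<and> open_cell n S \<inter> topspace (slice n UNIV) \<noteq> {}}"
    unfolding gl_chambers_def slice_UNIV[symmetric]
    by (rule chambers_in_slice[OF convex_UNIV]) (rule nz)
  moreover have "open_cell n S \<inter> topspace (slice n UNIV) = open_cell n S"
      "chamber_of n S \<inter> topspace (slice n UNIV) = chamber_of n S" for S
    by (auto simp: topspace_slice open_cell_def chamber_of_def weyl_chamber_def topspace_gl_space)
  ultimately show ?thesis
    by simp
qed

text \<open>
  For \<open>n \<ge> 3\<close> there is an index \<open>k\<close> besides \<open>i\<close> and \<open>j\<close>, and the vector with entry \<open>1 - n\<close> at \<open>k\<close>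
  and 1 elsewhere shows that the weight does not vanish on the hyperplane.
\<close>

lemma sl_chambers_eq:
  assumes "n \<ge> 3"
  shows "sl_chambers n
    = {chamber_of n S \<inter> sl_hyperplane n | S. S \<subseteq> {1..n} \<and> open_cell n S \<inter> sl_hyperplane n \<noteq> {}}"
proof -
  have nz: "\<exists>y\<in>topspace (slice n {0}). y i + y j \<noteq> 0" if "1 \<le> i" "i \<le> j" "j \<le> n" for i j
  proof -
    have "card {i, j} < card {1..n}"
      using assms by (simp add: card_insert_if)
    then have "{1..n} - {i, j} \<noteq> {}"
      by (metis Diff_eq_empty_iff card_mono finite.emptyI finite.insertI not_le)
    then obtain k where k: "k \<in> {1..n}" "k \<noteq> i" "k \<noteq> j"
      by blast
    define y where "y = (\<lambda>l\<in>{1..n}. 1 - (if l = k then real n else 0))"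
    have "(\<Sum>l=1..n. y l) = 0"
      using k(1) by (simp add: y_def sum_subtractf)
    then show ?thesis
      using that k by (intro bexI[of _ y]) (auto simp: topspace_slice y_def)
  qed
  have "sl_chambers n = chambers_in n (slice n {0})"
    using assms by (simp add: sl_chambers_def slice_0)
  also have "\<dots> = {chamber_of n S \<inter> sl_hyperplane n | S.
      S \<subseteq> {1..n} \<and> open_cell n S \<inter> sl_hyperplane n \<noteq> {}}"
    unfolding sl_hyperplane_eq by (rule chambers_in_slice[OF convex_singleton]) (rule nz)
  finally show ?thesis .
qed

text \<open>
  For \<open>n = 1\<close> the only weight vanishes identically on the hyperplane. For \<open>n = 2\<close> so does \<open>x\<^sub>1 + x\<^sub>2\<close>,
  and \<open>x\<^sub>1 > x\<^sub>2\<close> already forces \<open>x\<^sub>1 > 0 > x\<^sub>2\<close>. In both cases the strictly decreasing points form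
  one convex cell.
\<close>

lemma card_sl_chambers_small:
  assumes "n = 1 \<or> n = 2"
  shows "\<exists>D. sl_chambers n = {D}"
proof -
  let ?X = "slice n {0}"
  have interval: "{1..2} = {1, 2::nat}"
    unfolding set_eq_iff atLeastAtMost_iff insert_iff empty_iff by presburger
  have "regular_points n ?X = {x \<in> topspace ?X. strict_antimono_on {1..n} x}"
  proof -
    have "w x \<noteq> 0" if x: "x \<in> topspace ?X" "strict_antimono_on {1..n} x"
      and w: "w \<in> weights n" "y \<in> topspace ?X" "w y \<noteq> 0" for w x y
    proof -
      show ?thesis
      proof (cases "n = 1")
        case True
        have "w = (\<lambda>x. x 1)"
          using w(1) unfolding in_weights_iff True
        proof (elim disjE exE conjE)
          fix i assume "w = (\<lambda>x. x i)" "1 \<le> i" "i \<le> 1"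
          moreover from this have "i = 1" by linarith
          ultimately show ?thesis by blast
        qed linarith
        moreover have "y 1 = 0"
          using w(2) True by (simp add: topspace_slice)
        ultimately show ?thesis
          using w(3) by simp
      next
        case False
        then have n: "n = 2" using assms by simp
        have "x 1 > x 2"
          using monotone_onD[OF x(2), of 1 2] n by simp
        moreover have "x 1 + x 2 = 0" "y 1 + y 2 = 0"
          using x(1) w(2) n by (auto simp: topspace_slice interval)
        moreover have "w = (\<lambda>x. x 1) \<or> w = (\<lambda>x. x 2) \<or> w = (\<lambda>x. x 1 + x 2)"
          using w(1) unfolding in_weights_iff n
        proof (elim disjE exE conjE)
          fix i assume "w = (\<lambda>x. x i)" "1 \<le> i" "i \<le> 2"
          moreover from this have "i = 1 \<or> i = 2" by linarith
          ultimately show ?thesis by blast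
        next
          fix i j assume "w = (\<lambda>x. x i + x j)" "1 \<le> i" "i < j" "j \<le> 2"
          moreover from this have "i = 1 \<and> j = 2" by linarith
          ultimately show ?thesis by blast
        qed
        ultimately show ?thesis
          using w(3) by (elim disjE) simp_all
      qed
    qed
    note nonvanishing = this
    have "\<forall>w\<in>weights n. (\<exists>y\<in>topspace ?X. w y \<noteq> 0) \<longrightarrow> w x \<noteq> 0"
      if x: "x \<in> topspace ?X" "strict_antimono_on {1..n} x" for x
    proof (intro ballI impI)
      fix w assume w: "w \<in> weights n" and "\<exists>y\<in>topspace ?X. w y \<noteq> 0"
      then obtain y where "y \<in> topspace ?X" "w y \<noteq> 0"
        by (elim bexE)
      then show "w x \<noteq> 0"
        by (rule nonvanishing[OF x w])
    qed
    note all_nonzero = this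
    have restrict_all: "{x \<in> B. P x} = B" if "\<And>x. x \<in> B \<Longrightarrow> P x" for B :: "'a set" and P
      using that by blast
    show ?thesis
      unfolding regular_points_def interior_weyl_chamber
      by (rule restrict_all, rule all_nonzero) (simp_all only: mem_Collect_eq)
  qed
  then have reg: "regular_points n ?X = {x \<in> topspace ?X. \<forall>f\<in>gaps n. f x > 0}"
    unfolding gaps_pos_iff .
  define x where "x = (\<lambda>i\<in>{1..n}. (real n + 1) / 2 - real i)"
  have "(\<Sum>i=1..n. x i) = 0"
    using assms by (elim disjE) (simp_all add: x_def interval)
  moreover have "strict_antimono_on {1..n} x"
    by (rule monotone_onI) (simp add: x_def)
  moreover have "x \<in> extensional {1..n}"
    by (simp add: x_def)
  ultimately have x: "x \<in> regular_points n ?X"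
    unfolding reg gaps_pos_iff by (simp add: topspace_slice)
  have conn: "connectedin ?X (regular_points n ?X)"
    unfolding reg by (rule connectedin_cell[OF convex_singleton gaps_affine])
  then have top: "topspace (subtopology ?X (regular_points n ?X)) = regular_points n ?X"
    by (simp add: connectedin_def inf_absorb2)
  have "connected_components_of (subtopology ?X (regular_points n ?X)) = {regular_points n ?X}"
    unfolding connected_components_of_eq_singleton
  proof (intro conjI)
    show "connected_space (subtopology ?X (regular_points n ?X))"
      using conn by (simp add: connectedin_def)
    show "subtopology ?X (regular_points n ?X) \<noteq> trivial_topology"
      using x top by (metis empty_iff topspace_discrete_topology)
  qed (rule top[symmetric])
  then have "chambers_in n ?X = {?X closure_of regular_points n ?X}"
    unfolding chambers_in_def by simp
  moreover have "n \<noteq> 0"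
    using assms by linarith
  then have "sl_chambers n = chambers_in n ?X"
    by (simp add: sl_chambers_def slice_0)
  ultimately show ?thesis by blast
qed

section \<open>Signed absolute values\<close>

lemma positive_rank_eq:
  assumes x: "x \<in> generic n" and i: "i \<in> {1..n}" "x i > 0"
  shows "{j \<in> {i..n}. x i + x j > 0} = {j \<in> {1..n}. \<bar>x j\<bar> \<le> \<bar>x i\<bar>}"
proof (intro subset_antisym subsetI)
  fix j assume "j \<in> {j \<in> {i..n}. x i + x j > 0}"
  then have j: "i \<le> j" "j \<le> n" "x i + x j > 0"
    by simp_all
  have "x j \<le> x i"
    using monotone_onD[OF genericD(1)[OF x], of i j] i j by (cases "i = j") simp_all
  then show "j \<in> {j \<in> {1..n}. \<bar>x j\<bar> \<le> \<bar>x i\<bar>}"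
    using i j by simp
next
  fix j assume "j \<in> {j \<in> {1..n}. \<bar>x j\<bar> \<le> \<bar>x i\<bar>}"
  then have j: "1 \<le> j" "j \<le> n" "\<bar>x j\<bar> \<le> x i"
    using i by simp_all
  have "i \<le> j"
  proof (rule ccontr)
    assume "\<not> i \<le> j"
    then show False
      using monotone_onD[OF genericD(1)[OF x], of j i] i j by simp
  qed
  moreover from this have "x i + x j \<noteq> 0"
    using genericD(2)[OF x] i j by simp
  ultimately show "j \<in> {j \<in> {i..n}. x i + x j > 0}"
    using j by simp
qed

text \<open>
  The point is the decreasing rearrangement of the numbers \<open>s\<^sub>l c\<^sub>l\<close>; the rank of the absolute value
  \<open>c\<^sub>l\<close> is \<open>l\<close>, so the positive ranks are the elements of \<open>S\<close>. The value \<open>c 0 = 0\<close> makes strict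
  monotonicity on \<open>{0..n}\<close> express positivity as well.
\<close>

lemma open_cell_point_of_labels:
  fixes c :: "nat \<Rightarrow> real"
  assumes S: "S \<subseteq> {1..n}" and c: "strict_mono_on {0..n} c" "c 0 = 0"
  shows "\<exists>x\<in>open_cell n S. (\<Sum>i=1..n. x i) = (\<Sum>l=1..n. real_of_int (char_vec S l) * c l)"
proof -
  define v where "v l = real_of_int (char_vec S l) * c l" for l
  have c_less: "c l < c l' \<longleftrightarrow> l < l'" if "l \<le> n" "l' \<le> n" for l l'
    using that strict_mono_on_less[OF c(1), of l l'] by simp
  have c_pos: "c l > 0" if "l \<in> {1..n}" for l
    using c_less[of 0 l] c(2) that by simp
  have abs_v: "\<bar>v l\<bar> = c l" if "l \<in> {1..n}" for l
    using c_pos[OF that] by (simp add: v_def char_vec_def)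
  have v_pos: "v l > 0 \<longleftrightarrow> l \<in> S" if "l \<in> {1..n}" for l
    using c_pos[OF that] by (simp add: v_def char_vec_def)
  have c_inj: "l = l'" if "l \<in> {1..n}" "l' \<in> {1..n}" "c l = c l'" for l l'
    using c_less[of l l'] c_less[of l' l] that by simp
  have inj: "inj_on v {1..n}"
    by (rule inj_onI, rule c_inj) (simp_all flip: abs_v)
  define y where "y = (\<lambda>i. rev (sorted_list_of_set (v ` {1..n})) ! (i - 1))"
  have card: "card (v ` {1..n}) = n"
    using inj by (simp add: card_image)
  have y: "strict_antimono_on {1..n} y" "y ` {1..n} = v ` {1..n}"
    using rev_sorted_list_enumeration[of "v ` {1..n}"] unfolding card y_def by simp_all
  have inj_y: "inj_on y {1..n}"
    using y(1) by (simp add: strict_antimono_iff_antimono)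
  define x where "x = restrict y {1..n}"
  define r where "r i = inv_into {1..n} v (x i)" for i
  have x_img: "x ` {1..n} = v ` {1..n}"
    using y(2) by (simp add: x_def)
  have x_inj: "inj_on x {1..n}"
    using inj_y by (simp add: x_def inj_on_restrict_eq)
  have r: "r i \<in> {1..n}" "x i = v (r i)" if "i \<in> {1..n}" for i
  proof -
    have "x i \<in> v ` {1..n}"
      using x_img that by blast
    then show "r i \<in> {1..n}" "x i = v (r i)"
      by (simp_all only: r_def inv_into_into f_inv_into_f)
  qed
  have r_bij: "bij_betw r {1..n} {1..n}"
  proof -
    have "bij_betw x {1..n} (v ` {1..n})"
      using x_img x_inj by (simp add: bij_betw_def)
    moreover have "bij_betw (inv_into {1..n} v) (v ` {1..n}) {1..n}"
      by (rule bij_betw_inv_into) (simp add: bij_betw_def inj)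
    ultimately have "bij_betw (inv_into {1..n} v \<circ> x) {1..n} {1..n}"
      by (rule bij_betw_trans)
    then show ?thesis
      by (simp add: r_def comp_def fun_eq_iff cong: bij_betw_cong)
  qed
  have abs_x: "\<bar>x i\<bar> = c (r i)" if "i \<in> {1..n}" for i
    using r[OF that] abs_v by simp
  have anti: "strict_antimono_on {1..n} x"
    using y(1) by (simp add: x_def monotone_on_def)
  have gen: "x \<in> generic n"
  proof (rule genericI[OF _ anti])
    show "x \<in> extensional {1..n}"
      by (simp add: x_def)
    fix i j assume ij: "1 \<le> i" "i \<le> j" "j \<le> n"
    show "x i + x j \<noteq> 0"
    proof
      assume zero: "x i + x j = 0"
      then have "\<bar>x i\<bar> = \<bar>x j\<bar>" by linarith
      then have "r i = r j"
        using ij by (intro c_inj r) (simp_all add: abs_x)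
      then have "x i = x j"
        using r(2)[of i] r(2)[of j] ij by simp
      then have "\<bar>x i\<bar> = 0"
        using zero by simp
      then show False
        using abs_x[of i] c_pos[OF r(1)[of i]] ij by simp
    qed
  qed
  have "positive_ranks n x = r ` {i \<in> {1..n}. x i > 0}"
    unfolding positive_ranks_def
  proof (rule image_cong[OF refl])
    fix i assume "i \<in> {i \<in> {1..n}. x i > 0}"
    then have i: "i \<in> {1..n}" "x i > 0"
      by simp_all
    \<comment> \<open>The rank of \<open>x i\<close> is \<open>r i\<close>, as \<open>r\<close> permutes \<open>{1..n}\<close>.\<close>
    have "{j \<in> {1..n}. \<bar>x j\<bar> \<le> \<bar>x i\<bar>} = {j \<in> {1..n}. r j \<le> r i}"
    proof (rule Collect_cong, rule conj_cong[OF refl])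
      fix j assume j: "j \<in> {1..n}"
      have "c (r i) < c (r j) \<longleftrightarrow> r i < r j"
        using r(1)[OF i(1)] r(1)[OF j] by (intro c_less) simp_all
      then show "\<bar>x j\<bar> \<le> \<bar>x i\<bar> \<longleftrightarrow> r j \<le> r i"
        unfolding abs_x[OF i(1)] abs_x[OF j] by linarith
    qed
    moreover have "r ` {j \<in> {1..n}. r j \<le> r i} = {1..r i}"
    proof -
      have "r ` {j \<in> {1..n}. r j \<le> r i} = {l \<in> r ` {1..n}. l \<le> r i}"
        by blast
      also have "\<dots> = {1..r i}"
        using r_bij r(1)[OF i(1)] by (auto simp: bij_betw_def)
      finally show ?thesis .
    qed
    moreover have "inj_on r {j \<in> {1..n}. r j \<le> r i}"
      by (rule inj_on_subset[of _ "{1..n}"]) (use r_bij in \<open>auto simp: bij_betw_def\<close>)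
    ultimately have "card {j \<in> {1..n}. \<bar>x j\<bar> \<le> \<bar>x i\<bar>} = card {1..r i}"
      by (metis (no_types, lifting) card_image)
    then show "card {j \<in> {i..n}. x i + x j > 0} = r i"
      unfolding positive_rank_eq[OF gen i] by simp
  qed
  also have "\<dots> = r ` {i \<in> {1..n}. r i \<in> S}"
    using r v_pos by (intro arg_cong[where f = "(`) r"] Collect_cong conj_cong refl) simp
  also have "\<dots> = {l \<in> r ` {1..n}. l \<in> S}"
    by blast
  also have "\<dots> = S"
    using r_bij S by (auto simp: bij_betw_def)
  finally have "x \<in> open_cell n S"
    using generic_in_open_cell[OF gen] by simp
  moreover have "(\<Sum>i=1..n. x i) = (\<Sum>l=1..n. v l)"
    using sum.reindex[OF x_inj, of "\<lambda>y. y"] sum.reindex[OF inj, of "\<lambda>y. y"] x_img by simp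
  ultimately show ?thesis
    by (intro bexI[of _ x]) (simp_all add: v_def)
qed

text \<open>
  Conversely, ranking the coordinates of a generic point by absolute value is a permutation of
  \<open>{1..n}\<close>, because distinct coordinates have distinct absolute values; \<open>c\<^sub>l\<close> is the absolute value
  of rank \<open>l\<close>.
\<close>

lemma labels_of_generic_point:
  assumes x: "x \<in> generic n"
  obtains c :: "nat \<Rightarrow> real" where "strict_mono_on {0..n} c" "c 0 = 0"
    "(\<Sum>i=1..n. x i) = (\<Sum>l=1..n. real_of_int (char_vec (positive_ranks n x) l) * c l)"
proof -
  define B where "B i = {j \<in> {1..n}. \<bar>x j\<bar> \<le> \<bar>x i\<bar>}" for i
  define r where "r i = card (B i)" for i
  have nz: "x i \<noteq> 0" if "i \<in> {1..n}" for i
    using genericD(2)[OF x, of i i] that by simp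
  have distinct: "i = j" if ij: "i \<in> {1..n}" "j \<in> {1..n}" and eq: "\<bar>x i\<bar> = \<bar>x j\<bar>" for i j
  proof -
    have "x i + x j \<noteq> 0"
      using genericD(2)[OF x, of i j] genericD(2)[OF x, of j i] ij
      by (cases "i \<le> j") (simp_all add: add.commute)
    then have "x i = x j"
      using eq by linarith
    moreover have "inj_on x {1..n}"
      using genericD(1)[OF x] by (simp add: strict_antimono_iff_antimono)
    ultimately show "i = j"
      using ij by (simp add: inj_on_eq_iff)
  qed
  have r_less: "r i < r j" if "i \<in> {1..n}" "j \<in> {1..n}" "\<bar>x i\<bar> < \<bar>x j\<bar>" for i j
    unfolding r_def
  proof (rule psubset_card_mono)
    have "j \<in> B j" "j \<notin> B i" "B i \<subseteq> B j"
      using that by (auto simp: B_def)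
    then show "B i \<subset> B j" by blast
  qed (simp add: B_def)
  have r_less_iff: "r i < r j \<longleftrightarrow> \<bar>x i\<bar> < \<bar>x j\<bar>" if "i \<in> {1..n}" "j \<in> {1..n}" for i j
  proof
    assume "r i < r j"
    then show "\<bar>x i\<bar> < \<bar>x j\<bar>"
      using r_less[of j i] distinct[of i j] that by (metis less_asym' less_irrefl linorder_less_linear)
  qed (use r_less that in blast)
  have r_in: "r i \<in> {1..n}" if "i \<in> {1..n}" for i
  proof -
    have "i \<in> B i" "B i \<subseteq> {1..n}"
      using that by (auto simp: B_def)
    then have "card (B i) \<noteq> 0" "card (B i) \<le> card {1..n}"
      by (metis card_0_eq empty_iff finite_atLeastAtMost finite_subset)
         (rule card_mono, simp, fact)
    then show ?thesis
      unfolding r_def atLeastAtMost_iff by simp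
  qed
  have r_inj: "inj_on r {1..n}"
  proof (rule inj_onI)
    fix i j assume "i \<in> {1..n}" "j \<in> {1..n}" "r i = r j"
    then show "i = j"
      using r_less_iff[of i j] r_less_iff[of j i] by (intro distinct) simp_all
  qed
  have r_img: "r ` {1..n} = {1..n}"
    by (rule endo_inj_surj) (use r_in r_inj in auto)
  define q where "q = inv_into {1..n} r"
  have q: "q l \<in> {1..n}" "r (q l) = l" if "l \<in> {1..n}" for l
    using that inv_into_into[of l r "{1..n}"] f_inv_into_f[of l r "{1..n}"]
    unfolding q_def r_img by simp_all
  have qr: "q (r i) = i" if "i \<in> {1..n}" for i
    using r_inj that by (simp add: q_def)
  define c where "c l = (if l = 0 then 0 else \<bar>x (q l)\<bar>)" for l
  have "strict_mono_on {0..n} c"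
  proof (rule monotone_onI)
    fix l m assume lm: "l \<in> {0..n}" "m \<in> {0..n}" "l < m"
    show "c l < c m"
    proof (cases "l = 0")
      case True
      then show ?thesis
        using lm nz[OF q(1)[of m]] by (simp add: c_def)
    next
      case False
      then have "l \<in> {1..n}" "m \<in> {1..n}"
        using lm by auto
      then have "\<bar>x (q l)\<bar> < \<bar>x (q m)\<bar>"
        using r_less_iff[OF q(1) q(1), of l m] q(2) lm(3) by simp
      then show ?thesis
        using lm False by (simp add: c_def)
    qed
  qed
  moreover have "c 0 = 0"
    by (simp add: c_def)
  moreover have "(\<Sum>i=1..n. x i) = (\<Sum>l=1..n. real_of_int (char_vec (positive_ranks n x) l) * c l)"
  proof -
    have ranks: "positive_ranks n x = r ` {i \<in> {1..n}. x i > 0}"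
      unfolding positive_ranks_def
    proof (rule image_cong[OF refl])
      fix i assume "i \<in> {i \<in> {1..n}. x i > 0}"
      then have "i \<in> {1..n}" "x i > 0" by simp_all
      then show "card {j \<in> {i..n}. x i + x j > 0} = r i"
        by (simp only: positive_rank_eq[OF x] r_def B_def)
    qed
    have "x i = real_of_int (char_vec (positive_ranks n x) (r i)) * c (r i)" if i: "i \<in> {1..n}" for i
    proof -
      have "r i \<in> positive_ranks n x \<longleftrightarrow> i \<in> {i \<in> {1..n}. x i > 0}"
        unfolding ranks by (rule inj_on_image_mem_iff[OF r_inj i]) blast
      then have "r i \<in> positive_ranks n x \<longleftrightarrow> x i > 0"
        using i by simp
      moreover have "c (r i) = \<bar>x i\<bar>"
        using qr[OF i] r_in[OF i] by (simp add: c_def)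
      ultimately show ?thesis
        by (simp add: char_vec_def)
    qed
    then have "(\<Sum>i=1..n. x i)
        = (\<Sum>i=1..n. real_of_int (char_vec (positive_ranks n x) (r i)) * c (r i))"
      by (intro sum.cong refl)
    also have "\<dots> = (\<Sum>l\<in>r ` {1..n}. real_of_int (char_vec (positive_ranks n x) l) * c l)"
      by (subst sum.reindex[OF r_inj]) (simp add: comp_def)
    finally show ?thesis
      unfolding r_img .
  qed
  ultimately show ?thesis
    by (rule that)
qed

section \<open>Cells meeting the hyperplane\<close>

text \<open>
  Summation by parts: \<open>d\<^sub>m\<close> is multiplied by \<open>s\<^sub>l\<close> for exactly the \<open>l \<ge> m\<close>.
\<close>

lemma sum_by_suffixes:
  fixes s d :: "nat \<Rightarrow> 'a::comm_semiring_0"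
  shows "(\<Sum>l=1..n. s l * (\<Sum>m=1..l. d m)) = (\<Sum>m=1..n. d m * (\<Sum>l=m..n. s l))"
proof (induction n)
  case (Suc n)
  have "(\<Sum>m=1..Suc n. d m * (\<Sum>l=m..Suc n. s l))
      = (\<Sum>m=1..n. d m * (\<Sum>l=m..Suc n. s l)) + d (Suc n) * s (Suc n)"
    by simp
  also have "(\<Sum>m=1..n. d m * (\<Sum>l=m..Suc n. s l))
      = (\<Sum>m=1..n. d m * (\<Sum>l=m..n. s l) + d m * s (Suc n))"
    by (intro sum.cong refl) (simp add: distrib_left)
  finally show ?case
    using Suc.IH by (simp add: sum.distrib distrib_left sum_distrib_left mult.commute ac_simps)
qed simp

definition suffix_sum :: "nat \<Rightarrow> nat set \<Rightarrow> nat \<Rightarrow> int" where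
  "suffix_sum n S m = (\<Sum>l=m..n. char_vec S l)"

lemma sum_char_vec_by_suffixes:
  fixes d :: "nat \<Rightarrow> real"
  shows "(\<Sum>l=1..n. real_of_int (char_vec S l) * (\<Sum>m=1..l. d m))
    = (\<Sum>m=1..n. d m * real_of_int (suffix_sum n S m))"
  unfolding suffix_sum_def of_int_sum by (rule sum_by_suffixes)

text \<open>
  Writing \<open>c\<^sub>l = d\<^sub>1 + \<dots> + d\<^sub>l\<close> with positive increments, the coordinate sum becomes the combination
  of the suffix sums with the weights \<open>d\<^sub>m\<close>. As these weights are arbitrary positive numbers, the
  sum can vanish exactly when suffix sums of both signs occur; the last suffix sum is never 0.
\<close>

lemma open_cell_meets_hyperplane_iff:
  assumes S: "S \<subseteq> {1..n}" and n: "n \<ge> 1"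
  shows "open_cell n S \<inter> sl_hyperplane n \<noteq> {} \<longleftrightarrow>
    (\<exists>p\<in>{1..n}. suffix_sum n S p > 0) \<and> (\<exists>q\<in>{1..n}. suffix_sum n S q < 0)"
proof
  assume "open_cell n S \<inter> sl_hyperplane n \<noteq> {}"
  then obtain x where x: "x \<in> open_cell n S" "(\<Sum>i=1..n. x i) = 0"
    by (auto simp: sl_hyperplane_def)
  then have "x \<in> generic n" "positive_ranks n x = S"
    using open_cell_subset_generic positive_ranks_open_cell[OF S] by auto
  then obtain c :: "nat \<Rightarrow> real" where c: "strict_mono_on {0..n} c" "c 0 = 0"
    and sum: "(\<Sum>l=1..n. real_of_int (char_vec S l) * c l) = 0"
    using labels_of_generic_point[of x n] x(2) by metis
  define d where "d m = c m - c (m - 1)" for m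
  have d_pos: "d m > 0" if "m \<in> {1..n}" for m
    using strict_mono_onD[OF c(1), of "m - 1" m] that by (simp add: d_def)
  have "(\<Sum>m=1..l. d m) = c l" for l
    by (induction l) (simp_all add: d_def c(2))
  then have zero: "(\<Sum>m=1..n. d m * real_of_int (suffix_sum n S m)) = 0"
    using sum by (simp flip: sum_char_vec_by_suffixes)
  have last: "suffix_sum n S n \<noteq> 0"
    by (simp add: suffix_sum_def char_vec_def)
  \<comment> \<open>If \<open>a\<close> times every suffix sum were nonnegative, all terms of the vanishing sum would be 0.\<close>
  have mixed: "\<exists>m\<in>{1..n}. a * suffix_sum n S m < 0" if "a = 1 \<or> a = -1" for a :: int
  proof (rule ccontr)
    assume not_neg: "\<not> ?thesis"
    have nonneg: "d m * real_of_int (a * suffix_sum n S m) \<ge> 0" if "m \<in> {1..n}" for m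
    proof (rule mult_nonneg_nonneg[OF _ of_int_nonneg])
      show "d m \<ge> 0"
        using d_pos[OF that] by simp
      show "a * suffix_sum n S m \<ge> 0"
        using not_neg that by force
    qed
    have "(\<Sum>m=1..n. d m * real_of_int (a * suffix_sum n S m))
        = real_of_int a * (\<Sum>m=1..n. d m * real_of_int (suffix_sum n S m))"
      by (simp add: sum_distrib_left mult.left_commute)
    also have "\<dots> = 0"
      by (simp add: zero)
    finally have "\<forall>m\<in>{1..n}. d m * real_of_int (a * suffix_sum n S m) = 0"
      by (rule sum_nonneg_eq_0_iff[THEN iffD1, rotated 2]) (simp, rule nonneg)
    then have "d n * real_of_int (a * suffix_sum n S n) = 0"
      using n by (metis atLeastAtMost_iff order_refl)
    then show False
      using d_pos[of n] n last that by auto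
  qed
  show "(\<exists>p\<in>{1..n}. suffix_sum n S p > 0) \<and> (\<exists>q\<in>{1..n}. suffix_sum n S q < 0)"
    using mixed[of 1] mixed[of "-1"] by simp
next
  assume "(\<exists>p\<in>{1..n}. suffix_sum n S p > 0) \<and> (\<exists>q\<in>{1..n}. suffix_sum n S q < 0)"
  then obtain p q where p: "p \<in> {1..n}" "suffix_sum n S p > 0"
    and q: "q \<in> {1..n}" "suffix_sum n S q < 0"
    by blast
  define T where "T = (\<Sum>m=1..n. real_of_int (suffix_sum n S m))"
  \<comment> \<open>All weights are 1, except that one of them is increased to cancel the total \<open>T\<close>.\<close>
  define d where "d m = 1 + ((if m = q then max T 0 / - real_of_int (suffix_sum n S q) else 0)
      + (if m = p then max (- T) 0 / real_of_int (suffix_sum n S p) else 0))" for m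
  have d_pos: "d m > 0" for m
    using p(2) q(2) unfolding d_def by (intro add_pos_nonneg add_nonneg_nonneg) (auto simp: divide_nonneg_neg)
  define c where "c l = (\<Sum>m=1..l. d m)" for l
  have "strict_mono_on {0..n} c"
  proof (rule monotone_on_subset[of UNIV])
    show "strict_mono_on UNIV c"
      using d_pos by (intro strict_mono_Suc_iff[THEN iffD2]) (simp add: c_def)
  qed simp
  then obtain x where x: "x \<in> open_cell n S"
    "(\<Sum>i=1..n. x i) = (\<Sum>l=1..n. real_of_int (char_vec S l) * c l)"
    using open_cell_point_of_labels[OF S, of c] by (auto simp: c_def)
  have "(\<Sum>l=1..n. real_of_int (char_vec S l) * c l)
      = (\<Sum>m=1..n. d m * real_of_int (suffix_sum n S m))"
    unfolding c_def by (rule sum_char_vec_by_suffixes)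
  also have "\<dots> = T + (\<Sum>m=1..n. (if m = q then - max T 0 else 0) + (if m = p then max (- T) 0 else 0))"
    unfolding T_def sum.distrib[symmetric] using p(2) q(2)
    by (intro sum.cong refl) (simp add: d_def T_def[symmetric] distrib_right)
  also have "\<dots> = T - max T 0 + max (- T) 0"
    using p(1) q(1) by (simp add: sum.distrib)
  also have "\<dots> = 0"
    by (simp add: max_def)
  finally have "x \<in> sl_hyperplane n"
    using x by (simp add: sl_hyperplane_def topspace_gl_space open_cell_def)
  then show "open_cell n S \<inter> sl_hyperplane n \<noteq> {}"
    using x(1) by blast
qed

section \<open>Levels and the decreasing enumeration\<close>

lemma suffix_sum_eq:
  assumes "S \<subseteq> {1..n}" "m \<le> n + 1"
  shows "suffix_sum n S m = 2 * int (card (S \<inter> {m..})) - int (n + 1 - m)"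
proof -
  have "suffix_sum n S m = (\<Sum>l\<in>{m..n}. 2 * of_bool (l \<in> S) - 1)"
    unfolding suffix_sum_def by (intro sum.cong refl) (simp add: char_vec_def)
  also have "\<dots> = 2 * (\<Sum>l\<in>{m..n}. of_bool (l \<in> S)) - int (card {m..n})"
    by (simp add: sum_subtractf sum_distrib_left)
  also have "(\<Sum>l\<in>{m..n}. of_bool (l \<in> S)) = int (card ({m..n} \<inter> {l. l \<in> S}))"
    by (simp add: sum_of_bool_eq)
  also have "{m..n} \<inter> {l. l \<in> S} = S \<inter> {m..}"
    using assms by auto
  finally show ?thesis
    by simp
qed

lemma positive_level_iff:
  "(\<exists>i. positive_level n S i) \<longleftrightarrow> (\<exists>m\<in>{1..n}. suffix_sum n S m > 0)"
proof
  assume "\<exists>i. positive_level n S i"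
  then obtain i where i: "1 \<le> i" "i \<le> n" "suffix_sum n S (n - i + 1) > 0"
    unfolding positive_level_def suffix_sum_def by blast
  have "n - i + 1 \<in> {1..n}"
    using i(1,2) unfolding atLeastAtMost_iff by arith
  with i(3) show "\<exists>m\<in>{1..n}. suffix_sum n S m > 0"
    by (rule bexI)
next
  assume "\<exists>m\<in>{1..n}. suffix_sum n S m > 0"
  then obtain m where "1 \<le> m" "m \<le> n" "suffix_sum n S m > 0"
    by auto
  then show "\<exists>i. positive_level n S i"
    by (intro exI[of _ "n + 1 - m"]) (simp add: positive_level_def suffix_sum_def Suc_diff_le, arith)
qed

lemma negative_level_iff:
  "(\<exists>i. negative_level n S i) \<longleftrightarrow> (\<exists>m\<in>{1..n}. suffix_sum n S m < 0)"
proof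
  assume "\<exists>i. negative_level n S i"
  then obtain i where i: "1 \<le> i" "i \<le> n" "suffix_sum n S (n - i + 1) < 0"
    unfolding negative_level_def suffix_sum_def by blast
  have "n - i + 1 \<in> {1..n}"
    using i(1,2) unfolding atLeastAtMost_iff by arith
  with i(3) show "\<exists>m\<in>{1..n}. suffix_sum n S m < 0"
    by (rule bexI)
next
  assume "\<exists>m\<in>{1..n}. suffix_sum n S m < 0"
  then obtain m where "1 \<le> m" "m \<le> n" "suffix_sum n S m < 0"
    by auto
  then show "\<exists>i. negative_level n S i"
    by (intro exI[of _ "n + 1 - m"]) (simp add: negative_level_def suffix_sum_def Suc_diff_le, arith)
qed

text \<open>
  Suffix sums over an odd number of entries are odd, so their sign is decided by whether a majority
  of those entries lies in \<open>S\<close>, which is what the condition on the enumeration says.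
\<close>

lemma desc_ge_iff_suffix_sum:
  assumes S: "S \<subseteq> {1..n}" and i: "1 \<le> i" "2 * i \<le> n + 1"
  shows "int (desc S i) \<ge> int n + 2 - 2 * int i \<longleftrightarrow> suffix_sum n S (n + 2 - 2 * i) > 0"
    and "int (desc S i) < int n + 2 - 2 * int i \<longleftrightarrow> suffix_sum n S (n + 2 - 2 * i) < 0"
proof -
  have "finite S"
    using S finite_subset by blast
  then have "n + 2 - 2 * i \<le> desc S i \<longleftrightarrow> i \<le> card (S \<inter> {n + 2 - 2 * i..})"
    using i by (intro desc_ge_iff) linarith+
  moreover have "int (desc S i) \<ge> int n + 2 - 2 * int i \<longleftrightarrow> n + 2 - 2 * i \<le> desc S i"
    by linarith
  moreover have "suffix_sum n S (n + 2 - 2 * i)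
      = 2 * int (card (S \<inter> {n + 2 - 2 * i..})) - (2 * int i - 1)"
    using i by (subst suffix_sum_eq[OF S]) linarith+
  ultimately show "int (desc S i) \<ge> int n + 2 - 2 * int i \<longleftrightarrow> suffix_sum n S (n + 2 - 2 * i) > 0"
    and "int (desc S i) < int n + 2 - 2 * int i \<longleftrightarrow> suffix_sum n S (n + 2 - 2 * i) < 0"
    by linarith+
qed

text \<open>
  Removing one entry from an even, nonempty stretch changes the sum by 1, so a nonzero sum, being
  at least 2 in absolute value there, keeps its sign: levels of each sign already occur among the
  odd ones.
\<close>

lemma odd_level_suffices:
  fixes a :: int
  assumes S: "S \<subseteq> {1..n}" and a: "a = 1 \<or> a = -1"
  shows "(\<exists>m\<in>{1..n}. a * suffix_sum n S m > 0)
    \<longleftrightarrow> (\<exists>i. 1 \<le> i \<and> 2 * i \<le> n + 1 \<and> a * suffix_sum n S (n + 2 - 2 * i) > 0)"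
proof
  assume "\<exists>m\<in>{1..n}. a * suffix_sum n S m > 0"
  then obtain m where m: "1 \<le> m" "m \<le> n" "a * suffix_sum n S m > 0"
    by auto
  show "\<exists>i. 1 \<le> i \<and> 2 * i \<le> n + 1 \<and> a * suffix_sum n S (n + 2 - 2 * i) > 0"
  proof (cases "even (n - m)")
    case True
    then obtain k where k: "n - m = 2 * k"
      by blast
    then have "n = m + 2 * k"
      using m by simp
    then have "n + 2 - 2 * (k + 1) = m" "2 * (k + 1) \<le> n + 1"
      using m by simp_all
    then show ?thesis
      using m(3) by (intro exI[of _ "k + 1"]) simp
  next
    case False
    then obtain k where k: "n - m = 2 * k + 1"
      by (metis oddE)
    then have "n = m + 2 * k + 1"
      using m by simp
    then have eqs: "n + 2 - 2 * (k + 1) = m + 1" "2 * (k + 1) \<le> n + 1" "n + 1 - m = 2 * (k + 1)"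
      using m by simp_all
    have "{m..n} = insert m {m + 1..n}"
      using m by auto
    then have step: "suffix_sum n S m = char_vec S m + suffix_sum n S (m + 1)"
      by (simp add: suffix_sum_def)
    have "suffix_sum n S m = 2 * (int (card (S \<inter> {m..})) - int (k + 1))"
      using m eqs(3) by (subst suffix_sum_eq[OF S]) simp_all
    then have "even (a * suffix_sum n S m)"
      by simp
    then obtain b where "a * suffix_sum n S m = 2 * b"
      by (rule evenE)
    moreover from this have "2 * b > 0"
      using m(3) by simp
    then have "2 * b \<ge> 2"
      by arith
    ultimately have "a * suffix_sum n S m \<ge> 2"
      by simp
    moreover have "a * char_vec S m \<le> 1"
      using a by (auto simp: char_vec_def)
    ultimately have "a * suffix_sum n S (m + 1) > 0"
      unfolding step distrib_left by linarith
    then show ?thesis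
      using eqs by (intro exI[of _ "k + 1"]) simp
  qed
next
  assume "\<exists>i. 1 \<le> i \<and> 2 * i \<le> n + 1 \<and> a * suffix_sum n S (n + 2 - 2 * i) > 0"
  then obtain i where "1 \<le> i" "2 * i \<le> n + 1" "a * suffix_sum n S (n + 2 - 2 * i) > 0"
    by blast
  then show "\<exists>m\<in>{1..n}. a * suffix_sum n S m > 0"
    by (intro bexI[of _ "n + 2 - 2 * i"]) auto
qed

lemma desc_condition_iff_levels:
  assumes S: "S \<subseteq> {1..n}"
  shows "(\<exists>i j. 1 \<le> i \<and> int i \<le> \<lceil>real n / 2\<rceil> \<and> 1 \<le> j \<and> int j \<le> \<lceil>real n / 2\<rceil> \<and>
      int (desc S i) \<ge> int n + 2 - 2 * int i \<and> int (desc S j) < int n + 2 - 2 * int j)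
    \<longleftrightarrow> (\<exists>m\<in>{1..n}. suffix_sum n S m > 0) \<and> (\<exists>m\<in>{1..n}. suffix_sum n S m < 0)"
proof -
  have half: "int i \<le> \<lceil>real n / 2\<rceil> \<longleftrightarrow> 2 * i \<le> n + 1" for i
    by linarith
  have pos: "(\<exists>m\<in>{1..n}. suffix_sum n S m > 0) \<longleftrightarrow>
      (\<exists>i. 1 \<le> i \<and> int i \<le> \<lceil>real n / 2\<rceil> \<and> int (desc S i) \<ge> int n + 2 - 2 * int i)"
    using odd_level_suffices[OF S, of 1] desc_ge_iff_suffix_sum(1)[OF S]
    unfolding half mult_1 by metis
  have neg: "(\<exists>m\<in>{1..n}. suffix_sum n S m < 0) \<longleftrightarrow>
      (\<exists>i. 1 \<le> i \<and> int i \<le> \<lceil>real n / 2\<rceil> \<and> int (desc S i) < int n + 2 - 2 * int i)"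
    using odd_level_suffices[OF S, of "-1"] desc_ge_iff_suffix_sum(2)[OF S]
    unfolding half mult_minus1 neg_0_less_iff_less by metis
  show ?thesis
    unfolding pos neg by blast
qed

section \<open>Counting the subsets with levels of both signs\<close>

text \<open>
  Reading the signs from the top, a subset is a lattice path with steps \<open>\<plusminus>1\<close>. The set below holds
  the paths that start at height \<open>h\<close> and stay nonnegative; the index \<open>n + 1\<close> is the start itself.
\<close>

definition nonneg_paths :: "nat \<Rightarrow> int \<Rightarrow> nat set set" where
  "nonneg_paths n h = {S. S \<subseteq> {1..n} \<and> (\<forall>m\<in>{1..n + 1}. h + suffix_sum n S m \<ge> 0)}"

lemma finite_nonneg_paths: "finite (nonneg_paths n h)"
  by (rule finite_subset[of _ "Pow {1..n}"]) (auto simp: nonneg_paths_def)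

lemma suffix_sum_top [simp]: "suffix_sum n S (Suc n) = 0"
  by (simp add: suffix_sum_def)

lemma suffix_sum_Suc:
  "m \<le> Suc n \<Longrightarrow> suffix_sum (Suc n) S m = suffix_sum n S m + char_vec S (Suc n)"
  by (simp add: suffix_sum_def)

lemma suffix_sum_insert:
  "suffix_sum n (insert (Suc n) S) m = suffix_sum n S m"
  unfolding suffix_sum_def by (rule sum.cong) (auto simp: char_vec_def)

lemma nonneg_paths_step:
  assumes "S \<subseteq> {1..Suc n}" "h \<ge> 0"
  shows "S \<in> nonneg_paths (Suc n) h \<longleftrightarrow>
    (\<forall>m\<in>{1..n + 1}. h + char_vec S (Suc n) + suffix_sum n S m \<ge> 0)"
proof -
  have "{1..Suc n + 1} = insert (Suc (Suc n)) {1..n + 1}"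
    by auto
  then show ?thesis
    using assms by (auto simp: nonneg_paths_def suffix_sum_Suc ac_simps)
qed

text \<open>
  Split off the first step, which goes down unless \<open>Suc n\<close> belongs to the set. For \<open>h = 0\<close> the
  first set is that of the paths from height \<open>-1\<close>; it is empty because the starting height counts.
\<close>

lemma nonneg_paths_Suc:
  assumes h: "h \<ge> 0"
  shows "nonneg_paths (Suc n) h = nonneg_paths n (h - 1) \<union> insert (Suc n) ` nonneg_paths n (h + 1)"
proof (intro subset_antisym subsetI)
  fix S assume S: "S \<in> nonneg_paths (Suc n) h"
  then have sub: "S \<subseteq> {1..Suc n}"
    by (simp add: nonneg_paths_def)
  note step = nonneg_paths_step[OF sub h, THEN iffD1, OF S]
  show "S \<in> nonneg_paths n (h - 1) \<union> insert (Suc n) ` nonneg_paths n (h + 1)"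
  proof (cases "Suc n \<in> S")
    case True
    define T where "T = S - {Suc n}"
    have T: "S = insert (Suc n) T" "T \<subseteq> {1..n}"
      using True sub by (auto simp: T_def le_Suc_eq)
    have "T \<in> nonneg_paths n (h + 1)"
      using step T by (simp add: nonneg_paths_def suffix_sum_insert char_vec_def)
    then show ?thesis
      using T(1) by blast
  next
    case False
    then have "S \<subseteq> {1..n}"
      using sub by (auto simp: le_Suc_eq)
    then have "S \<in> nonneg_paths n (h - 1)"
      using step False by (simp add: nonneg_paths_def char_vec_def)
    then show ?thesis by blast
  qed
next
  fix S assume "S \<in> nonneg_paths n (h - 1) \<union> insert (Suc n) ` nonneg_paths n (h + 1)"
  then show "S \<in> nonneg_paths (Suc n) h"
  proof
    assume S: "S \<in> nonneg_paths n (h - 1)"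
    then have "S \<subseteq> {1..n}"
      by (simp add: nonneg_paths_def)
    then have "S \<subseteq> {1..Suc n}" "Suc n \<notin> S"
      by auto
    then show ?thesis
      using S nonneg_paths_step[OF _ h] by (simp add: nonneg_paths_def char_vec_def)
  next
    assume "S \<in> insert (Suc n) ` nonneg_paths n (h + 1)"
    then obtain T where T: "S = insert (Suc n) T" "T \<in> nonneg_paths n (h + 1)"
      by blast
    then have "T \<subseteq> {1..n}"
      by (simp add: nonneg_paths_def)
    then have "S \<subseteq> {1..Suc n}"
      using T(1) by auto
    then show ?thesis
      using T nonneg_paths_step[OF _ h] by (simp add: nonneg_paths_def suffix_sum_insert char_vec_def)
  qed
qed

lemma card_nonneg_paths_Suc:
  assumes h: "h \<ge> 0"
  shows "card (nonneg_paths (Suc n) h) = card (nonneg_paths n (h - 1)) + card (nonneg_paths n (h + 1))"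
proof -
  have no: "Suc n \<notin> S" if "S \<in> nonneg_paths n g" for S g
    using that by (auto simp: nonneg_paths_def)
  have "inj_on (insert (Suc n)) (nonneg_paths n (h + 1))"
    by (rule inj_onI) (metis no insert_ident)
  moreover have "nonneg_paths n (h - 1) \<inter> insert (Suc n) ` nonneg_paths n (h + 1) = {}"
    using no by blast
  ultimately show ?thesis
    by (simp add: nonneg_paths_Suc[OF h] card_Un_disjoint finite_nonneg_paths card_image)
qed

lemma nonneg_paths_neg:
  assumes "h < 0"
  shows "nonneg_paths n h = {}"
proof -
  have "h \<ge> 0" if "S \<in> nonneg_paths n h" for S
  proof -
    have "h + suffix_sum n S (n + 1) \<ge> 0"
      using that unfolding nonneg_paths_def by simp
    then show ?thesis
      by (simp add: suffix_sum_def)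
  qed
  then show ?thesis
    using assms by force
qed

text \<open>
  By the reflection principle the number of nonnegative paths of length \<open>n\<close> from height \<open>h\<close> is the
  number of all paths whose displacement \<open>2 j - n\<close> lies between \<open>-h\<close> and \<open>h + 1\<close>. Both sides satisfy
  the same recursion, by Pascal's rule for the window sums.
\<close>

definition window :: "nat \<Rightarrow> int \<Rightarrow> int \<Rightarrow> nat" where
  "window n a b = (\<Sum>j\<le>n. if a \<le> 2 * int j - int n \<and> 2 * int j - int n \<le> b then n choose j else 0)"

lemma window_Suc: "window (Suc n) a b = window n (a - 1) (b - 1) + window n (a + 1) (b + 1)"
proof -
  let ?P = "\<lambda>j. a \<le> 2 * int j - int (Suc n) \<and> 2 * int j - int (Suc n) \<le> b"
  have "window (Suc n) a b = (if ?P 0 then 1 else 0)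
      + (\<Sum>j\<le>n. if ?P (Suc j) then Suc n choose Suc j else 0)"
    unfolding window_def by (subst sum.atMost_Suc_shift) simp
  also have "(\<Sum>j\<le>n. if ?P (Suc j) then Suc n choose Suc j else 0)
      = (\<Sum>j\<le>n. if ?P (Suc j) then n choose j else 0) + (\<Sum>j\<le>n. if ?P (Suc j) then n choose Suc j else 0)"
    by (subst sum.distrib[symmetric], rule sum.cong) auto
  also have "(\<Sum>j\<le>n. if ?P (Suc j) then n choose j else 0) = window n (a - 1) (b - 1)"
    unfolding window_def by (rule sum.cong[OF refl], rule if_cong) (auto simp: algebra_simps)
  also have "(if ?P 0 then 1 else 0)
      + (window n (a - 1) (b - 1) + (\<Sum>j\<le>n. if ?P (Suc j) then n choose Suc j else 0))
      = window n (a - 1) (b - 1) + (\<Sum>j\<le>Suc n. if ?P j then n choose j else 0)"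
    by (subst sum.atMost_Suc_shift[where n = n]) simp
  also have "(\<Sum>j\<le>Suc n. if ?P j then n choose j else 0) = window n (a + 1) (b + 1)"
  proof -
    have "n choose Suc n = 0"
      by (simp add: binomial_eq_0)
    then show ?thesis
      unfolding window_def sum.atMost_Suc
      by (simp only: if_cancel add_0_right) (rule sum.cong[OF refl], rule if_cong, auto)
  qed
  finally show ?thesis .
qed

lemma window_split:
  assumes "a \<le> b + 1" "b \<le> c"
  shows "window n a c = window n a b + window n (b + 1) c"
  unfolding window_def sum.distrib[symmetric] using assms by (intro sum.cong refl) auto

lemma card_nonneg_paths: "h \<ge> -1 \<Longrightarrow> card (nonneg_paths n h) = window n (- h) (h + 1)"
proof (induction n arbitrary: h)
  case 0
  show ?case
  proof (cases "h = -1")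
    case True
    then show ?thesis
      by (simp add: nonneg_paths_neg window_def)
  next
    case False
    then have "nonneg_paths 0 h = {{}}"
      using 0 by (auto simp: nonneg_paths_def suffix_sum_def)
    then show ?thesis
      using False 0 by (simp add: window_def)
  qed
next
  case (Suc n)
  show ?case
  proof (cases "h = -1")
    case True
    then show ?thesis
      by (simp add: nonneg_paths_neg window_def)
  next
    case False
    then have h: "h \<ge> 0"
      using Suc.prems by simp
    have "card (nonneg_paths (Suc n) h) = window n (1 - h) h + window n (- h - 1) (2 + h)"
      using h by (simp add: card_nonneg_paths_Suc Suc.IH)
    moreover have "window n (- h - 1) (2 + h) = window n (- h - 1) h + window n (h + 1) (2 + h)"
      using h by (intro window_split) simp_all
    moreover have "window n (1 - h) (2 + h) = window n (1 - h) h + window n (h + 1) (2 + h)"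
      using h by (intro window_split) simp_all
    ultimately show ?thesis
      by (simp add: window_Suc)
  qed
qed

lemma card_nonneg_paths_0: "card (nonneg_paths n 0) = n choose (n div 2)"
proof -
  \<comment> \<open>The only displacement of the right parity in \<open>{0, 1}\<close> comes from \<open>j = \<lceil>n/2\<rceil>\<close>.\<close>
  have "window n 0 1 = (\<Sum>j\<le>n. if j = n - n div 2 then n choose j else 0)"
    unfolding window_def by (intro sum.cong refl if_cong) linarith
  also have "\<dots> = n choose (n - n div 2)"
    by simp
  also have "\<dots> = n choose (n div 2)"
    by (rule binomial_symmetric[symmetric]) simp
  finally show ?thesis
    using card_nonneg_paths[of 0 n] by simp
qed

lemma suffix_sum_complement:
  assumes "1 \<le> m"
  shows "suffix_sum n ({1..n} - S) m = - suffix_sum n S m"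
  unfolding suffix_sum_def sum_negf[symmetric] using assms
  by (intro sum.cong refl) (auto simp: char_vec_def)

lemma card_mixed_subsets:
  assumes n: "n \<ge> 1"
  shows "int (card {S. S \<subseteq> {1..n} \<and> (\<exists>m\<in>{1..n}. suffix_sum n S m > 0) \<and> (\<exists>m\<in>{1..n}. suffix_sum n S m < 0)})
    = 2 ^ n - 2 * int (n choose (n div 2))"
proof -
  define N where "N = {S. S \<subseteq> {1..n} \<and> (\<forall>m\<in>{1..n}. suffix_sum n S m \<ge> 0)}"
  define P where "P = {S. S \<subseteq> {1..n} \<and> (\<forall>m\<in>{1..n}. suffix_sum n S m \<le> 0)}"
  have "{1..n + 1} = insert (Suc n) {1..n}"
    by auto
  then have "N = nonneg_paths n 0"
    by (simp add: N_def nonneg_paths_def)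
  then have card_N: "card N = n choose (n div 2)"
    by (simp add: card_nonneg_paths_0)
  have "bij_betw (\<lambda>S. {1..n} - S) N P"
  proof (rule bij_betw_byWitness[where f' = "\<lambda>S. {1..n} - S"])
    show "\<forall>S\<in>N. {1..n} - ({1..n} - S) = S" "\<forall>S\<in>P. {1..n} - ({1..n} - S) = S"
      by (simp_all add: N_def P_def double_diff)
    show "(\<lambda>S. {1..n} - S) ` N \<subseteq> P" "(\<lambda>S. {1..n} - S) ` P \<subseteq> N"
      by (auto simp: N_def P_def suffix_sum_complement)
  qed
  then have card_P: "card P = n choose (n div 2)"
    using card_N bij_betw_same_card by metis
  have "suffix_sum n S n \<noteq> 0" for S
    by (simp add: suffix_sum_def char_vec_def)
  then have disj: "N \<inter> P = {}"
    using n unfolding N_def P_def by (auto intro!: bexI[of _ n]) (metis atLeastAtMost_iff order_antisym order_refl)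
  have fin: "finite N" "finite P"
    by (rule finite_subset[of _ "Pow {1..n}"]; auto simp: N_def P_def)+
  have "{S. S \<subseteq> {1..n} \<and> (\<exists>m\<in>{1..n}. suffix_sum n S m > 0) \<and> (\<exists>m\<in>{1..n}. suffix_sum n S m < 0)}
      = Pow {1..n} - (N \<union> P)"
    by (auto simp: N_def P_def not_le)
  moreover have "N \<union> P \<subseteq> Pow {1..n}"
    by (auto simp: N_def P_def)
  moreover have "card (N \<union> P) = 2 * (n choose (n div 2))"
    using card_Un_disjoint[OF fin disj] card_N card_P by simp
  moreover have "card (N \<union> P) \<le> 2 ^ n"
    using card_mono[OF _ \<open>N \<union> P \<subseteq> Pow {1..n}\<close>] by (simp add: card_Pow)
  ultimately show ?thesis
    using fin by (simp add: card_Diff_subset card_Pow of_nat_diff)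
qed

section \<open>The generating function\<close>

text \<open>
  The power series \<open>Z = \<Sum> C(2m, m) y\<^sup>m\<close> equals \<open>1 / sqrt (1 - 4y)\<close>: the ratio of consecutive
  coefficients says \<open>(1 - 4y) Z' = 2 Z\<close>, so that \<open>(1 - 4y) Z\<^sup>2\<close> has derivative 0.
\<close>

definition central_fps :: "real fps" where
  "central_fps = Abs_fps (\<lambda>m. of_nat ((2 * m) choose m))"

lemma central_binomial_ratio:
  "(Suc m) * ((2 * Suc m) choose (Suc m)) = (4 * m + 2) * ((2 * m) choose m)"
proof -
  have "Suc m * ((2 * Suc m) choose Suc m) = 2 * (Suc m * (Suc (2 * m) choose m))"
    using Suc_times_binomial[of m "Suc (2 * m)"] by (simp add: algebra_simps)
  also have "Suc (2 * m) choose m = Suc (2 * m) choose Suc m"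
    using binomial_symmetric[of m "Suc (2 * m)"] by simp
  also have "Suc m * (Suc (2 * m) choose Suc m) = Suc (2 * m) * ((2 * m) choose m)"
    by (rule Suc_times_binomial)
  finally show ?thesis
    by (simp add: algebra_simps)
qed

lemma central_fps_deriv: "(1 - 4 * fps_X) * fps_deriv central_fps = 2 * central_fps"
proof (rule fps_ext)
  fix m
  have ratio: "real (Suc m) * real ((2 * Suc m) choose Suc m) = (4 * real m + 2) * real ((2 * m) choose m)" for m
    using arg_cong[OF central_binomial_ratio[of m], of real] by (simp only: of_nat_mult of_nat_add of_nat_numeral)
  have deriv_nth: "fps_nth (fps_deriv central_fps) m = real (Suc m) * real ((2 * Suc m) choose Suc m)" for m
    by (simp only: fps_deriv_nth central_fps_def fps_nth_Abs_fps Suc_eq_plus1)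
  have shifted: "fps_nth (fps_X * fps_deriv central_fps) m = real m * real ((2 * m) choose m)"
    by (cases m) (simp, simp only: fps_X_mult_nth deriv_nth, simp)
  have "fps_nth ((1 - 4 * fps_X) * fps_deriv central_fps) m
      = fps_nth (fps_deriv central_fps) m - 4 * fps_nth (fps_X * fps_deriv central_fps) m"
    by (simp add: left_diff_distrib mult.assoc numeral_fps_const)
  also have "\<dots> = (4 * real m + 2) * real ((2 * m) choose m) - 4 * (real m * real ((2 * m) choose m))"
    by (simp only: shifted deriv_nth ratio)
  also have "\<dots> = 2 * real ((2 * m) choose m)"
    by (simp add: algebra_simps)
  also have "\<dots> = 2 * fps_nth central_fps m"
    by (simp add: central_fps_def)
  finally show "fps_nth ((1 - 4 * fps_X) * fps_deriv central_fps) m = fps_nth (2 * central_fps) m"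
    by (simp add: numeral_fps_const)
qed

lemma central_fps_square: "(1 - 4 * fps_X) * central_fps ^ 2 = 1"
proof -
  let ?G = "(1 - 4 * fps_X) * central_fps ^ 2"
  have "fps_deriv ?G = 2 * central_fps * ((1 - 4 * fps_X) * fps_deriv central_fps) - 4 * central_fps ^ 2"
    by (simp add: power2_eq_square algebra_simps fps_deriv_mult)
  also have "\<dots> = 0"
    unfolding central_fps_deriv by (simp add: power2_eq_square)
  finally have "?G = fps_const (fps_nth ?G 0)"
    by (simp only: fps_deriv_eq_0_iff)
  also have "fps_nth ?G 0 = 1"
    by (simp add: central_fps_def power2_eq_square)
  finally show ?thesis
    by simp
qed

definition central_fps_X2 :: "real fps" where
  "central_fps_X2 = fps_compose central_fps (fps_X ^ 2)"

lemma central_fps_X2_nth: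
  "fps_nth central_fps_X2 n = (if even n then of_nat (n choose (n div 2)) else 0)"
  unfolding central_fps_X2_def fps_nth_compose_X_power central_fps_def by auto

lemma central_fps_X2_square: "(1 - 4 * fps_X ^ 2) * central_fps_X2 ^ 2 = 1"
proof -
  have "fps_compose ((1 - 4 * fps_X) * central_fps ^ 2) (fps_X ^ 2 :: real fps) = 1"
    unfolding central_fps_square by simp
  then show ?thesis
    by (simp add: central_fps_X2_def fps_compose_mult_distrib fps_compose_sub_distrib
        fps_compose_power numeral_fps_const)
qed

lemma sqrt_fps_eq: "sqrt_fps = (1 - 4 * fps_X ^ 2) * central_fps_X2"
proof -
  have "((1 - 4 * fps_X ^ 2) * central_fps_X2) ^ 2
      = (1 - 4 * fps_X ^ 2) * ((1 - 4 * fps_X ^ 2) * central_fps_X2 ^ 2)"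
    by (simp add: power2_eq_square ac_simps)
  also have "\<dots> = 1 - 4 * fps_X ^ 2"
    unfolding central_fps_X2_square by simp
  finally have "((1 - 4 * fps_X ^ 2) * central_fps_X2) ^ 2 = 1 - 4 * fps_X ^ 2" .
  moreover have "fps_nth ((1 - 4 * fps_X ^ 2) * central_fps_X2) 0 = 1"
    by (simp add: central_fps_X2_nth power2_eq_square)
  ultimately show ?thesis
    by (metis sqrt_fps_characterization)
qed

definition middle_binomial_fps :: "real fps" where
  "middle_binomial_fps = Abs_fps (\<lambda>n. of_nat (n choose (n div 2)))"

text \<open>
  At \<open>x\<^sup>k\<^sup>+\<^sup>1\<close> with \<open>k\<close> even, both coefficients are \<open>2 C(k, k/2)\<close>. With \<open>k = 2 m + 1\<close>, Pascal's rule and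
  the symmetry of row \<open>k\<close> give \<open>C(k + 1, m + 1) = 2 C(k, m)\<close>.
\<close>

lemma middle_binomial_fps_eq:
  "1 + 2 * fps_X * middle_binomial_fps = (1 + 2 * fps_X) * central_fps_X2"
proof (rule fps_ext)
  fix n
  show "fps_nth (1 + 2 * fps_X * middle_binomial_fps) n = fps_nth ((1 + 2 * fps_X) * central_fps_X2) n"
  proof (cases n)
    case 0
    then show ?thesis
      by (simp add: central_fps_X2_nth)
  next
    case (Suc k)
    have L: "fps_nth (1 + 2 * fps_X * middle_binomial_fps) n = 2 * real (k choose (k div 2))"
      using Suc by (simp add: mult.assoc numeral_fps_const middle_binomial_fps_def)
    have R: "fps_nth ((1 + 2 * fps_X) * central_fps_X2) n
        = fps_nth central_fps_X2 (Suc k) + 2 * fps_nth central_fps_X2 k"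
      using Suc by (simp add: distrib_right mult.assoc numeral_fps_const)
    show ?thesis
    proof (cases "even k")
      case True
      then show ?thesis
        unfolding L R by (simp add: central_fps_X2_nth)
    next
      case False
      then obtain m where k: "k = 2 * m + 1"
        by (rule oddE)
      then have "m \<le> k" "k - m = Suc m"
        by simp_all
      then have "k choose Suc m = k choose m"
        using binomial_symmetric[of m k] by simp
      then have "Suc k choose Suc m = 2 * (k choose m)"
        by simp
      then show ?thesis
        unfolding L R using k by (simp add: central_fps_X2_nth)
    qed
  qed
qed

text \<open>
  Multiplying \<open>1 + 2 x B = (1 + 2 x) Z(x\<^sup>2)\<close> by \<open>1 - 2 x\<close> gives \<open>(1 - 4 x\<^sup>2) Z(x\<^sup>2)\<close> on the right,
  which is the square root because \<open>(1 - 4 x\<^sup>2) Z(x\<^sup>2)\<^sup>2 = 1\<close>.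
\<close>

lemma sqrt_fps_middle_binomial:
  "sqrt_fps + 2 * fps_X - 1 = 2 * fps_X * (1 - 2 * fps_X) * middle_binomial_fps"
proof -
  have "sqrt_fps = (1 - 2 * fps_X) * ((1 + 2 * fps_X) * central_fps_X2)"
    unfolding sqrt_fps_eq by (simp add: algebra_simps power2_eq_square)
  also have "\<dots> = (1 - 2 * fps_X) * (1 + 2 * fps_X * middle_binomial_fps)"
    by (simp only: middle_binomial_fps_eq)
  finally show ?thesis
    by (simp add: algebra_simps)
qed

lemma geometric_fps: "(1 - 2 * fps_X) * Abs_fps (\<lambda>n. 2 ^ n :: real) = 1"
proof (rule fps_ext)
  fix n
  show "fps_nth ((1 - 2 * fps_X) * Abs_fps (\<lambda>n. 2 ^ n :: real)) n = fps_nth 1 n"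
    by (cases n) (simp_all add: left_diff_distrib mult.assoc numeral_fps_const)
qed

lemma fls_one_minus_2X_nonzero: "1 - 2 * fls_X \<noteq> (0 :: real fls)"
proof
  assume "1 - 2 * fls_X = (0 :: real fls)"
  then have "fls_nth (1 - 2 * fls_X :: real fls) 0 = 0"
    by simp
  then show False
    by (simp add: mult.commute[of 2])
qed

lemma generating_function:
  fixes a :: "nat \<Rightarrow> nat"
  assumes a: "\<And>n. int (a n) = 2 ^ n - 2 * int (n choose (n div 2))
    + of_bool (n = 0) + of_bool (n = 1) + of_bool (n = 2)"
  shows "fps_to_fls (Abs_fps (\<lambda>n. real (a n))) =
    1 / (1 - 2 * fls_X) - (sqrt_fls + 2 * fls_X - 1) / (fls_X * (1 - 2 * fls_X)) + 1 + fls_X + fls_X ^ 2"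
proof -
  let ?B = "fps_to_fls middle_binomial_fps" and ?P = "fps_to_fls (Abs_fps (\<lambda>n. 2 ^ n :: real))"
  have "real (a n) = 2 ^ n - 2 * real (n choose (n div 2))
      + of_bool (n = 0) + of_bool (n = 1) + of_bool (n = 2)" for n
    using arg_cong[OF a[of n], of real_of_int] by simp
  then have "Abs_fps (\<lambda>n. real (a n))
      = Abs_fps (\<lambda>n. 2 ^ n) - 2 * middle_binomial_fps + 1 + fps_X + fps_X ^ 2"
    by (intro fps_ext) (simp add: middle_binomial_fps_def numeral_fps_const fps_X_power_nth)
  then have lhs: "fps_to_fls (Abs_fps (\<lambda>n. real (a n))) = ?P - 2 * ?B + 1 + fls_X + fls_X ^ 2"
    by (simp add: fls_plus_const fps_to_fls_power fls_times_fps_to_fls)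
  have "fps_to_fls ((1 - 2 * fps_X) * Abs_fps (\<lambda>n. 2 ^ n :: real)) = 1"
    unfolding geometric_fps by simp
  then have "(1 - 2 * fls_X) * ?P = 1"
    by (simp add: fls_times_fps_to_fls)
  then have P: "?P = 1 / (1 - 2 * fls_X)"
    using fls_one_minus_2X_nonzero by (simp add: eq_divide_eq mult.commute)
  have "sqrt_fls + 2 * fls_X - 1 = fps_to_fls (sqrt_fps + 2 * fps_X - 1)"
    by (simp add: sqrt_fls_def fls_times_fps_to_fls)
  also have "\<dots> = 2 * ?B * (fls_X * (1 - 2 * fls_X))"
    unfolding sqrt_fps_middle_binomial by (simp add: fls_times_fps_to_fls ac_simps)
  finally have "(sqrt_fls + 2 * fls_X - 1) / (fls_X * (1 - 2 * fls_X)) = 2 * ?B"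
    using fls_one_minus_2X_nonzero by simp
  then show ?thesis
    unfolding lhs P by simp
qed

lemma generating_function_closed_form:
  "1 / (1 - 2 * fls_X) - (sqrt_fls + 2 * fls_X - 1) / (fls_X * (1 - 2 * fls_X)) + 1 + fls_X + fls_X ^ 2
    = (2 * fls_X ^ 4 + fls_X ^ 3 + fls_X ^ 2 + sqrt_fls - 1) / (fls_X * (2 * fls_X - 1))"
proof -
  define x :: "real fls" where "x = fls_X"
  have nz: "x \<noteq> 0" "1 - 2 * x \<noteq> 0"
    using fls_one_minus_2X_nonzero by (simp_all add: x_def)
  let ?D = "x * (1 - 2 * x)"
  have D: "?D \<noteq> 0"
    using nz by simp
  have "1 / (1 - 2 * x) = x / ?D"
    using nz by simp
  moreover have "1 + x + x ^ 2 = (1 + x + x ^ 2) * ?D / ?D"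
    using D by simp
  ultimately have "1 / (1 - 2 * x) - (sqrt_fls + 2 * x - 1) / ?D + (1 + x + x ^ 2)
      = (x - (sqrt_fls + 2 * x - 1) + (1 + x + x ^ 2) * ?D) / ?D"
    by (simp only: add_divide_distrib diff_divide_distrib)
  also have "x - (sqrt_fls + 2 * x - 1) + (1 + x + x ^ 2) * ?D
      = - (2 * x ^ 4 + x ^ 3 + x ^ 2 + sqrt_fls - 1)"
    by (simp add: algebra_simps power2_eq_square power3_eq_cube power4_eq_xxxx)
  also have "- (2 * x ^ 4 + x ^ 3 + x ^ 2 + sqrt_fls - 1) / ?D
      = (2 * x ^ 4 + x ^ 3 + x ^ 2 + sqrt_fls - 1) / (- ?D)"
    by (simp only: divide_minus_right minus_divide_left)
  also have "- ?D = x * (2 * x - 1)"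
    by (simp add: algebra_simps)
  finally show ?thesis
    unfolding x_def by (simp only: add.assoc)
qed

section \<open>The chambers of the hyperplane arrangement\<close>

abbreviation mixed :: "nat \<Rightarrow> nat set \<Rightarrow> bool" where
  "mixed n S \<equiv> (\<exists>m\<in>{1..n}. suffix_sum n S m > 0) \<and> (\<exists>m\<in>{1..n}. suffix_sum n S m < 0)"

text \<open>
  A point of the open cell lies in no other closed cell, so a chamber of the hyperplane determines
  the subset that it comes from.
\<close>

lemma open_cell_point_determines_subset:
  assumes S: "S \<subseteq> {1..n}" and T: "T \<subseteq> {1..n}" and x: "x \<in> open_cell n S" "x \<in> chamber_of n T"
  shows "S = T"
proof -
  have gen: "x \<in> generic n"
    using open_cell_subset_generic x(1) by (rule subsetD)
  have "positive_ranks n x = S" "positive_ranks n x = T"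
    using positive_ranks_open_cell[OF S x(1)]
      positive_ranks_open_cell[OF T generic_in_chamber_of[OF gen x(2)]] by simp_all
  then show ?thesis by simp
qed

lemma open_cell_subset_chamber_of: "open_cell n S \<subseteq> chamber_of n S"
proof
  fix x assume x: "x \<in> open_cell n S"
  then have top: "x \<in> topspace (slice n UNIV)"
    by (simp add: open_cell_def topspace_slice)
  have "x \<in> {x \<in> topspace (slice n UNIV). \<forall>f\<in>gaps n \<union> signed_sums n S. f x > 0}"
    using x top open_cell_eq[of n S UNIV] by (metis IntI)
  then have "x \<in> {x \<in> topspace (slice n UNIV). \<forall>f\<in>gaps n \<union> signed_sums n S. f x \<ge> 0}"
    by (simp add: less_imp_le)
  then show "x \<in> chamber_of n S"
    unfolding chamber_of_eq[symmetric] by (rule IntD1)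
qed

lemma sl_chamber_mem_iff:
  assumes n: "n \<ge> 3" and S: "S \<subseteq> {1..n}"
  shows "chamber_of n S \<inter> sl_hyperplane n \<in> sl_chambers n \<longleftrightarrow> mixed n S"
proof -
  have "chamber_of n S \<inter> sl_hyperplane n \<in> sl_chambers n \<longleftrightarrow> open_cell n S \<inter> sl_hyperplane n \<noteq> {}"
  proof
    assume "chamber_of n S \<inter> sl_hyperplane n \<in> sl_chambers n"
    then obtain T where T: "T \<subseteq> {1..n}" "open_cell n T \<inter> sl_hyperplane n \<noteq> {}"
      and eq: "chamber_of n S \<inter> sl_hyperplane n = chamber_of n T \<inter> sl_hyperplane n"
      unfolding sl_chambers_eq[OF n] by blast
    then obtain x where x: "x \<in> open_cell n T" "x \<in> sl_hyperplane n"
      by blast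
    then have "x \<in> chamber_of n S"
      using eq subsetD[OF open_cell_subset_chamber_of x(1)] by blast
    then have "T = S"
      using open_cell_point_determines_subset[OF T(1) S x(1)] by blast
    then show "open_cell n S \<inter> sl_hyperplane n \<noteq> {}"
      using T(2) by simp
  next
    assume "open_cell n S \<inter> sl_hyperplane n \<noteq> {}"
    then show "chamber_of n S \<inter> sl_hyperplane n \<in> sl_chambers n"
      unfolding sl_chambers_eq[OF n] using S by blast
  qed
  also have "\<dots> \<longleftrightarrow> mixed n S"
    using n by (intro open_cell_meets_hyperplane_iff[OF S]) simp
  finally show ?thesis .
qed

lemma sl_chamber_extends_uniquely:
  assumes n: "n \<ge> 3" and D: "D \<in> sl_chambers n"
  shows "\<exists>!C. C \<in> gl_chambers n \<and> D = C \<inter> sl_hyperplane n"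
proof -
  obtain S x where S: "S \<subseteq> {1..n}" "D = chamber_of n S \<inter> sl_hyperplane n"
    and x: "x \<in> open_cell n S" "x \<in> sl_hyperplane n"
    using D unfolding sl_chambers_eq[OF n] by blast
  show ?thesis
  proof (rule ex1I)
    show "chamber_of n S \<in> gl_chambers n \<and> D = chamber_of n S \<inter> sl_hyperplane n"
      unfolding gl_chambers_eq using S x(1) by blast
  next
    fix C assume C: "C \<in> gl_chambers n \<and> D = C \<inter> sl_hyperplane n"
    then obtain T where T: "T \<subseteq> {1..n}" "C = chamber_of n T"
      unfolding gl_chambers_eq by blast
    have "x \<in> D"
      using S(2) x subsetD[OF open_cell_subset_chamber_of x(1)] by blast
    then have "x \<in> chamber_of n T"
      using C T(2) by blast
    then show "C = chamber_of n S"
      using open_cell_point_determines_subset[OF S(1) T(1) x(1)] T(2) by blast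
  qed
qed

lemma card_sl_chambers:
  "finite (sl_chambers n) \<and> int (card (sl_chambers n))
    = 2 ^ n - 2 * int (n choose (n div 2)) + of_bool (n = 0) + of_bool (n = 1) + of_bool (n = 2)"
proof -
  consider "n = 0" | "n = 1 \<or> n = 2" | "n \<ge> 3"
    by linarith
  then show ?thesis
  proof cases
    case 1
    then show ?thesis
      by (simp add: sl_chambers_def)
  next
    case 2
    from card_sl_chambers_small[OF 2] obtain D where "sl_chambers n = {D}"
      by (elim exE)
    then have single: "finite (sl_chambers n)" "card (sl_chambers n) = 1"
      by simp_all
    have "2 ^ n - 2 * int (n choose (n div 2)) + of_bool (n = 0) + of_bool (n = 1) + of_bool (n = 2) = (1::int)"
      using 2
    proof
      assume n: "n = 1"
      show ?thesis unfolding n by simp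
    next
      assume n: "n = 2"
      have "(2::nat) div 2 = 1" by simp
      then show ?thesis unfolding n by (simp add: choose_one)
    qed
    then show ?thesis
      unfolding single(2) using single(1) by simp
  next
    case 3
    let ?I = "{S. S \<subseteq> {1..n} \<and> mixed n S}"
    let ?D = "\<lambda>S. chamber_of n S \<inter> sl_hyperplane n"
    have "n \<ge> 1"
      using 3 by simp
    note meets = open_cell_meets_hyperplane_iff[OF _ \<open>n \<ge> 1\<close>]
    have "sl_chambers n = ?D ` {S. S \<subseteq> {1..n} \<and> open_cell n S \<inter> sl_hyperplane n \<noteq> {}}"
      unfolding sl_chambers_eq[OF 3] by (simp only: image_Collect)
    also have "{S. S \<subseteq> {1..n} \<and> open_cell n S \<inter> sl_hyperplane n \<noteq> {}} = ?I"
      by (rule Collect_cong, rule conj_cong[OF refl], rule meets)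
    finally have eq: "sl_chambers n = ?D ` ?I" .
    have "inj_on ?D ?I"
    proof (rule inj_onI)
      fix S T assume S: "S \<in> ?I" and T: "T \<in> ?I" and eq: "?D S = ?D T"
      have sub: "S \<subseteq> {1..n}" "T \<subseteq> {1..n}"
        using S T by (simp_all only: mem_Collect_eq)
      have "mixed n S"
        using S by (simp only: mem_Collect_eq)
      then have "open_cell n S \<inter> sl_hyperplane n \<noteq> {}"
        unfolding meets[OF sub(1)] .
      then obtain x where x: "x \<in> open_cell n S" "x \<in> sl_hyperplane n"
        by blast
      then have "x \<in> chamber_of n T"
        using eq subsetD[OF open_cell_subset_chamber_of x(1)] by blast
      then show "S = T"
        by (rule open_cell_point_determines_subset[OF sub x(1)])
    qed
    then have "card (sl_chambers n) = card ?I"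
      unfolding eq by (rule card_image)
    moreover have "finite ?I"
      by (rule finite_subset[of _ "Pow {1..n}"]) (blast, simp)
    then have "finite (sl_chambers n)"
      unfolding eq by (rule finite_imageI)
    ultimately show ?thesis
      using card_mixed_subsets[OF \<open>n \<ge> 1\<close>] 3 by simp
  qed
qed

theorem theorem3p3:
  shows
    "(\<forall>n\<ge>3. \<forall>D\<in>sl_chambers n. \<exists>!C. C \<in> gl_chambers n \<and> D = C \<inter> sl_hyperplane n)
     \<and>
     (\<forall>n. finite (sl_chambers n) \<and>
        int (card (sl_chambers n)) =
          2 ^ n - 2 * int (n choose nat \<lfloor>real n / 2\<rfloor>)
          + of_bool (n = 0) + of_bool (n = 1) + of_bool (n = 2))
     \<and>
     fps_to_fls (Abs_fps (\<lambda>n. real (card (sl_chambers n)))) =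
       1 / (1 - 2 * fls_X) - (sqrt_fls + 2 * fls_X - 1) / (fls_X * (1 - 2 * fls_X))
       + 1 + fls_X + fls_X ^ 2
     \<and>
     1 / (1 - 2 * fls_X) - (sqrt_fls + 2 * fls_X - 1) / (fls_X * (1 - 2 * fls_X))
       + 1 + fls_X + fls_X ^ 2
     = (2 * fls_X ^ 4 + fls_X ^ 3 + fls_X ^ 2 + sqrt_fls - 1) / (fls_X * (2 * fls_X - 1))
     \<and>
     (\<forall>n\<ge>3. \<forall>S\<subseteq>{1..n}.
        (chamber_of n S \<inter> sl_hyperplane n \<in> sl_chambers n \<longleftrightarrow>
           (\<exists>i j. 1 \<le> i \<and> int i \<le> \<lceil>real n / 2\<rceil> \<and> 1 \<le> j \<and> int j \<le> \<lceil>real n / 2\<rceil> \<and>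
              int (desc S i) \<ge> int n + 2 - 2 * int i \<and>
              int (desc S j) < int n + 2 - 2 * int j))
        \<and>
        ((\<exists>i j. 1 \<le> i \<and> int i \<le> \<lceil>real n / 2\<rceil> \<and> 1 \<le> j \<and> int j \<le> \<lceil>real n / 2\<rceil> \<and>
              int (desc S i) \<ge> int n + 2 - 2 * int i \<and>
              int (desc S j) < int n + 2 - 2 * int j) \<longleftrightarrow>
           (\<exists>i. positive_level n S i) \<and> (\<exists>j. negative_level n S j)))"
proof (intro conjI allI impI ballI)
  fix n :: nat and D
  assume "3 \<le> n" "D \<in> sl_chambers n"
  then show "\<exists>!C. C \<in> gl_chambers n \<and> D = C \<inter> sl_hyperplane n"
    by (rule sl_chamber_extends_uniquely)
next
  fix n :: nat
  have half: "nat \<lfloor>real n / 2\<rfloor> = n div 2"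
    using floor_divide_of_nat_eq[of n 2, where ?'a = real] by simp
  show "finite (sl_chambers n)"
    using card_sl_chambers by blast
  show "int (card (sl_chambers n)) = 2 ^ n - 2 * int (n choose nat \<lfloor>real n / 2\<rfloor>)
      + of_bool (n = 0) + of_bool (n = 1) + of_bool (n = 2)"
    unfolding half using card_sl_chambers by blast
next
  show "fps_to_fls (Abs_fps (\<lambda>n. real (card (sl_chambers n)))) =
      1 / (1 - 2 * fls_X) - (sqrt_fls + 2 * fls_X - 1) / (fls_X * (1 - 2 * fls_X)) + 1 + fls_X + fls_X ^ 2"
    by (rule generating_function) (rule conjunct2[OF card_sl_chambers])
next
  show "1 / (1 - 2 * fls_X) - (sqrt_fls + 2 * fls_X - 1) / (fls_X * (1 - 2 * fls_X)) + 1 + fls_X + fls_X ^ 2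
      = (2 * fls_X ^ 4 + fls_X ^ 3 + fls_X ^ 2 + sqrt_fls - 1) / (fls_X * (2 * fls_X - 1))"
    by (rule generating_function_closed_form)
next
  fix n :: nat and S :: "nat set"
  assume n: "3 \<le> n" and S: "S \<subseteq> {1..n}"
  note desc = desc_condition_iff_levels[OF S]
  show "chamber_of n S \<inter> sl_hyperplane n \<in> sl_chambers n \<longleftrightarrow>
      (\<exists>i j. 1 \<le> i \<and> int i \<le> \<lceil>real n / 2\<rceil> \<and> 1 \<le> j \<and> int j \<le> \<lceil>real n / 2\<rceil> \<and>
        int (desc S i) \<ge> int n + 2 - 2 * int i \<and> int (desc S j) < int n + 2 - 2 * int j)"
    unfolding desc by (rule sl_chamber_mem_iff[OF n S])
  show "(\<exists>i j. 1 \<le> i \<and> int i \<le> \<lceil>real n / 2\<rceil> \<and> 1 \<le> j \<and> int j \<le> \<lceil>real n / 2\<rceil> \<and>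
        int (desc S i) \<ge> int n + 2 - 2 * int i \<and> int (desc S j) < int n + 2 - 2 * int j) \<longleftrightarrow>
      (\<exists>i. positive_level n S i) \<and> (\<exists>j. negative_level n S j)"
    unfolding desc positive_level_iff negative_level_iff ..
qed

end
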